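(* Let $x,s\in\mathrm{int}\,\mathcal{K}$ satisfy $x=\mu s^{-1}$ for some $\mu>0$. Let $w=\frac1{\sqrt\mu}x$ and $d=d_N(w,\mu)$. Then: (a) $p=w$, where $p$ is the scaling point $Q(x^{1/2})(Q(x^{1/2})s)^{-1/2}$. (b) $d_x=d$ and $d_s=-d$, where $(d_x,d_s)$ is the Nesterov–Todd (NT) direction at $(x,s)$. (c) $x'=\sqrt\mu\,Q(w^{1/2})(e+d)$ and $s'=\sqrt\mu\,Q(w^{-1/2})(e-d)$, where $(x',s')$ is the NT update of $(x,s)$, and $e+d$ and $e-d$ are the first-order Taylor expansions of $\exp(d)$ and $\exp(-d)$ at $d=0$.
   Context: Setting. $\mathcal{J}$ is a (finite-dimensional real) Euclidean Jordan algebra of rank $n$ with product $\circ$, identity $e$, trace $\mathrm{tr}$, inner product $\langle u,v\rangle=\mathrm{tr}(u\circ v)$. $\mathcal{K}=\{u\circ u:u\in\mathcal{J}\}$ is its cone of squares, with interior $\mathrm{int}\,\mathcal{K}$. Functions such as $\exp$, $u^{1/2}$, $u^{-1}$ are applied spectrally. $Q(u)v:=2u\circ(u\circ v)-(u\circ u)\circ v$. $\mathcal{L}\subseteq\mathcal{J}$ is a linear subspace with orthogonal complement $\mathcal{L}^\perp$, and $x_0,s_0\in\mathcal{J}$. Standing assumption (Slater): $\mathrm{int}\,\mathcal{K}\cap(x_0+\mathcal{L})\neq\emptyset$ and $\mathrm{int}\,\mathcal{K}\cap(s_0+\mathcal{L}^\perp)\ne\emptyset$. Newton direction. For $w\in\mathrm{int}\,\mathcal{K}$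 and $\mu>0$, $d_N(w,\mu)$ is the unique $d\in\mathcal{J}$ with $Q(w^{1/2})(e+d)\in\frac1{\sqrt\mu}x_0+\mathcal{L}$ and $Q(w^{-1/2})(e-d)\in\frac1{\sqrt\mu}s_0+\mathcal{L}^\perp$. NT direction and update. For $x,s\in\mathrm{int}\,\mathcal{K}$ and $\mu>0$, let $p:=Q(x^{1/2})(Q(x^{1/2})s)^{-1/2}$ (the scaling point) and $v:=\frac1{\sqrt\mu}Q(p^{-1/2})x$. The NT direction is the unique $(d_x,d_s)\in\mathcal{J}\times\mathcal{J}$ satisfying \[ x+\sqrt\mu\,Q(p^{1/2})d_x\in x_0+\mathcal{L},\quad s+\sqrt\mu\,Q(p^{-1/2})d_s\in s_0+\mathcal{L}^\perp,\quad d_x+d_s=v^{-1}-v, \] and the NT update is $x':=x+\sqrt\mu\,Q(p^{1/2})d_x$, $s':=s+\sqrt\mu\,Q(p^{-1/2})d_s$. *)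

theory Defs
  imports "HOL-Analysis.Analysis"
begin

section \<open>Euclidean Jordan algebras\<close>

class jordan_algebra = euclidean_space +
  fixes jprod :: "'a \<Rightarrow> 'a \<Rightarrow> 'a"  (infixl "\<odot>" 70)
    and jone :: "'a"
  assumes jprod_commute: "u \<odot> v = v \<odot> u"
    and jprod_add_left: "(u + v) \<odot> w = u \<odot> w + v \<odot> w"
    and jprod_scaleR_left: "(r *\<^sub>R u) \<odot> v = r *\<^sub>R (u \<odot> v)"
    and jone_left: "jone \<odot> u = u"
    and jordan_identity: "u \<odot> ((u \<odot> u) \<odot> v) = (u \<odot> u) \<odot> (u \<odot> v)"
begin

definition primitive_idempotent :: "'a \<Rightarrow> bool" where
  "primitive_idempotent c \<longleftrightarrow>
     c \<noteq> 0 \<and> c \<odot> c = c \<and>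
     \<not> (\<exists>a b. a \<noteq> 0 \<and> b \<noteq> 0 \<and> a \<odot> a = a \<and> b \<odot> b = b \<and> a \<odot> b = 0 \<and> c = a + b)"

text \<open>Members of a Jordan frame are nonzero and pairwise orthogonal, hence pairwise distinct, so a
  frame is a set, and an eigenvalue list is a function on that set.\<close>

definition jordan_frame :: "'a set \<Rightarrow> bool" where
  "jordan_frame C \<longleftrightarrow>
     finite C \<and> (\<forall>c\<in>C. primitive_idempotent c) \<and>
     (\<forall>c\<in>C. \<forall>c'\<in>C. c \<noteq> c' \<longrightarrow> c \<odot> c' = 0) \<and> (\<Sum>c\<in>C. c) = jone"

definition spectral_decomposition :: "'a \<Rightarrow> 'a set \<Rightarrow> ('a \<Rightarrow> real) \<Rightarrow> bool" where
  "spectral_decomposition u C l \<longleftrightarrow> jordan_frame C \<and> u = (\<Sum>c\<in>C. l c *\<^sub>R c)"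

definition jtrace :: "'a \<Rightarrow> real" where
  "jtrace u = (THE t. \<exists>C l. spectral_decomposition u C l \<and> t = (\<Sum>c\<in>C. l c))"

definition jspectral :: "(real \<Rightarrow> real) \<Rightarrow> 'a \<Rightarrow> 'a" where
  "jspectral f u =
     (THE y. \<exists>C l. spectral_decomposition u C l \<and> y = (\<Sum>c\<in>C. f (l c) *\<^sub>R c))"

primrec jpower :: "'a \<Rightarrow> nat \<Rightarrow> 'a" where
  "jpower u 0 = jone"
| "jpower u (Suc k) = u \<odot> jpower u k"

text \<open>The degree of the minimal polynomial of \<open>u\<close>.\<close>

definition jdegree :: "'a \<Rightarrow> nat" where
  "jdegree u = (LEAST m. \<exists>a. jpower u m = (\<Sum>i<m. a i *\<^sub>R jpower u i))"

end

text \<open>An algebra is Euclidean if it carries some associative inner product. Independently of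
  that form, the inner product of the type (and so its norm, topology and orthogonality)
  is the trace inner product. Associativity of the latter is not assumed.\<close>

class euclidean_jordan_algebra = jordan_algebra +
  assumes ex_associative_inner:
      "\<exists>B :: 'a \<Rightarrow> 'a \<Rightarrow> real.
         (\<forall>u v w. B (u + v) w = B u w + B v w) \<and>
         (\<forall>r u v. B (r *\<^sub>R u) v = r * B u v) \<and>
         (\<forall>u v. B u v = B v u) \<and>
         (\<forall>u. u \<noteq> 0 \<longrightarrow> B u u > 0) \<and>
         (\<forall>u v w. B (u \<odot> v) w = B v (u \<odot> w))"
    and inner_eq_jtrace: "u \<bullet> v = jtrace (u \<odot> v)"

definition jordan_rank :: "'a::euclidean_jordan_algebra itself \<Rightarrow> nat" where
  "jordan_rank _ = Max (range (jdegree :: 'a \<Rightarrow> nat))"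

definition square_cone :: "'a::euclidean_jordan_algebra set" where
  "square_cone = {u \<odot> u |u. True}"

definition jexp :: "'a::euclidean_jordan_algebra \<Rightarrow> 'a" where
  "jexp = jspectral exp"

definition jinv :: "'a::euclidean_jordan_algebra \<Rightarrow> 'a" where
  "jinv = jspectral inverse"

text \<open>Real powers, meant for elements of the interior of the cone, whose eigenvalues are
  positive.\<close>

definition jpowr :: "'a::euclidean_jordan_algebra \<Rightarrow> real \<Rightarrow> 'a" where
  "jpowr u a = jspectral (\<lambda>t. t powr a) u"

definition jquad :: "'a::euclidean_jordan_algebra \<Rightarrow> 'a \<Rightarrow> 'a" where
  "jquad u v = 2 *\<^sub>R (u \<odot> (u \<odot> v)) - (u \<odot> u) \<odot> v"


section \<open>Newton and Nesterov--Todd directions\<close>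

definition affine_translate :: "'a::euclidean_jordan_algebra \<Rightarrow> 'a set \<Rightarrow> 'a set" where
  "affine_translate a L = {a + l |l. l \<in> L}"

definition slater :: "'a::euclidean_jordan_algebra set \<Rightarrow> 'a \<Rightarrow> 'a \<Rightarrow> bool" where
  "slater L x0 s0 \<longleftrightarrow>
     interior square_cone \<inter> affine_translate x0 L \<noteq> {} \<and>
     interior square_cone \<inter> affine_translate s0 (orthogonal_comp L) \<noteq> {}"

definition newton_direction ::
    "'a::euclidean_jordan_algebra set \<Rightarrow> 'a \<Rightarrow> 'a \<Rightarrow> 'a \<Rightarrow> real \<Rightarrow> 'a" where
  "newton_direction L x0 s0 w \<mu> =
     (THE d. jquad (jpowr w (1/2)) (jone + d) \<in> affine_translate ((1 / sqrt \<mu>) *\<^sub>R x0) L \<and>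
             jquad (jpowr w (-1/2)) (jone - d)
               \<in> affine_translate ((1 / sqrt \<mu>) *\<^sub>R s0) (orthogonal_comp L))"

definition scaling_point :: "'a::euclidean_jordan_algebra \<Rightarrow> 'a \<Rightarrow> 'a" where
  "scaling_point x s = jquad (jpowr x (1/2)) (jpowr (jquad (jpowr x (1/2)) s) (-1/2))"

definition nt_scaled :: "'a::euclidean_jordan_algebra \<Rightarrow> 'a \<Rightarrow> real \<Rightarrow> 'a" where
  "nt_scaled x s \<mu> = (1 / sqrt \<mu>) *\<^sub>R jquad (jpowr (scaling_point x s) (-1/2)) x"

definition nt_step ::
    "'a::euclidean_jordan_algebra \<Rightarrow> 'a \<Rightarrow> real \<Rightarrow> 'a \<times> 'a \<Rightarrow> 'a \<times> 'a" where
  "nt_step x s \<mu> = (\<lambda>(dx, ds).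
     (x + sqrt \<mu> *\<^sub>R jquad (jpowr (scaling_point x s) (1/2)) dx,
      s + sqrt \<mu> *\<^sub>R jquad (jpowr (scaling_point x s) (-1/2)) ds))"

definition nt_direction ::
    "'a::euclidean_jordan_algebra set \<Rightarrow> 'a \<Rightarrow> 'a \<Rightarrow> 'a \<Rightarrow> 'a \<Rightarrow> real \<Rightarrow> 'a \<times> 'a" where
  "nt_direction L x0 s0 x s \<mu> =
     (THE d. fst (nt_step x s \<mu> d) \<in> affine_translate x0 L \<and>
             snd (nt_step x s \<mu> d) \<in> affine_translate s0 (orthogonal_comp L) \<and>
             fst d + snd d = jinv (nt_scaled x s \<mu>) - nt_scaled x s \<mu>)"

definition nt_update ::
    "'a::euclidean_jordan_algebra set \<Rightarrow> 'a \<Rightarrow> 'a \<Rightarrow> 'a \<Rightarrow> 'a \<Rightarrow> real \<Rightarrow> 'a \<times> 'a" where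
  "nt_update L x0 s0 x s \<mu> = nt_step x s \<mu> (nt_direction L x0 s0 x s \<mu>)"

text \<open>\<open>T\<close> is the first-order Taylor expansion of \<open>f\<close> at \<open>a\<close>, as a function of the
  displacement.\<close>

definition first_order_taylor ::
    "('a::real_normed_vector \<Rightarrow> 'b::real_normed_vector) \<Rightarrow> 'a \<Rightarrow> ('a \<Rightarrow> 'b) \<Rightarrow> bool" where
  "first_order_taylor f a T \<longleftrightarrow>
     (\<exists>f'. (f has_derivative f') (at a) \<and> (\<forall>h. T h = f a + f' h))"

end

theory Submission
  imports Defs "HOL-Computational_Algebra.Polynomial"
begin

text \<open>On the central path \<open>x\<close> and \<open>s\<close> have a common Jordan frame, on which the scaling point, \<open>v\<close> and
  the quadratic maps are computed eigenvalue by eigenvalue: the scaling point is \<open>w\<close> and \<open>v = e\<close>. The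
  system for the NT direction therefore becomes the Newton system with \<open>ds = - dx\<close>, and both
  directions agree because that system has a unique solution. Uniqueness rests on two properties of
  \<open>T = Q(w^(1/2))\<close> and \<open>S = Q(w^(-1/2))\<close>: they are inverse to each other, which follows from the
  linearized Jordan identity because multiplications by members of a frame commute, and they are
  self-adjoint for the trace form, since the Peirce reflection of an idempotent preserves the trace.\<close>

lemma bilinear_jprod: "bilinear ((\<odot>) :: 'a::jordan_algebra \<Rightarrow> 'a \<Rightarrow> 'a)"
  unfolding bilinear_def
proof (intro allI conjI linearI)
  fix x y z :: 'a and r :: real
  show "x \<odot> (y + z) = x \<odot> y + x \<odot> z"
    by (metis jprod_add_left jprod_commute)
  show "x \<odot> (r *\<^sub>R y) = r *\<^sub>R (x \<odot> y)"
    by (metis jprod_scaleR_left jprod_commute)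
qed (auto simp: jprod_add_left jprod_scaleR_left)

interpretation jprod: bounded_bilinear "(\<odot>) :: 'a::jordan_algebra \<Rightarrow> 'a \<Rightarrow> 'a"
  using bilinear_jprod bilinear_conv_bounded_bilinear by blast

lemma jone_right [simp]: "u \<odot> jone = u"
  by (metis jone_left jprod_commute)

declare jone_left [simp]

section \<open>Linearization of the Jordan identity\<close>

lemma jordan_linearized:
  fixes a b c v :: "'a::jordan_algebra"
  shows "a \<odot> ((b \<odot> c) \<odot> v) + b \<odot> ((c \<odot> a) \<odot> v) + c \<odot> ((a \<odot> b) \<odot> v)
       = (b \<odot> c) \<odot> (a \<odot> v) + (c \<odot> a) \<odot> (b \<odot> v) + (a \<odot> b) \<odot> (c \<odot> v)"
    (is "?l = ?r")
proof -
  define J where "J u = u \<odot> ((u \<odot> u) \<odot> v) - (u \<odot> u) \<odot> (u \<odot> v)" for u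
  have J0: "J u = 0" for u
    by (simp add: J_def jordan_identity)
  have comm: "c \<odot> b = b \<odot> c" "a \<odot> c = c \<odot> a" "b \<odot> a = a \<odot> b"
    by (auto intro: jprod_commute)
  \<comment> \<open>\<open>J\<close> is cubic in \<open>u\<close>, so this alternating sum is its
    full polarization; the 2 counts the orderings in the polarized square.\<close>
  have "J (a + b + c) - J (a + b) - J (b + c) - J (c + a) + J a + J b + J c = 2 *\<^sub>R (?l - ?r)"
    unfolding J_def
    by (simp add: jprod.add_left jprod.add_right comm algebra_simps scaleR_2)
  then show ?thesis
    by (simp add: J0)
qed

text \<open>The right-hand side of the linearized identity is symmetric in all four arguments, so \<open>v\<close> and
  \<open>a\<close> may be exchanged on the left.\<close>

lemma jprod_triple:
  fixes a b c v :: "'a::jordan_algebra"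
  shows "(a \<odot> (b \<odot> c)) \<odot> v = (b \<odot> c) \<odot> (a \<odot> v) + (c \<odot> a) \<odot> (b \<odot> v) + (a \<odot> b) \<odot> (c \<odot> v)
       - b \<odot> (a \<odot> (c \<odot> v)) - c \<odot> (a \<odot> (b \<odot> v))"
proof -
  have "v \<odot> ((b \<odot> c) \<odot> a) + b \<odot> ((c \<odot> v) \<odot> a) + c \<odot> ((v \<odot> b) \<odot> a)
      = (b \<odot> c) \<odot> (v \<odot> a) + (c \<odot> v) \<odot> (b \<odot> a) + (v \<odot> b) \<odot> (c \<odot> a)"
    by (rule jordan_linearized)
  moreover have "v \<odot> ((b \<odot> c) \<odot> a) = (a \<odot> (b \<odot> c)) \<odot> v" "(c \<odot> v) \<odot> a = a \<odot> (c \<odot> v)"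
    "(v \<odot> b) \<odot> a = a \<odot> (b \<odot> v)" "v \<odot> a = a \<odot> v" "(c \<odot> v) \<odot> (b \<odot> a) = (a \<odot> b) \<odot> (c \<odot> v)"
    "(v \<odot> b) \<odot> (c \<odot> a) = (c \<odot> a) \<odot> (b \<odot> v)"
    by (metis jprod_commute)+
  ultimately show ?thesis
    by (simp add: algebra_simps)
qed

text \<open>With two arguments equal to \<open>c\<close>, the terms of the linearized identity
  containing \<open>c \<odot> d\<close> vanish, and only the commutation is left.\<close>

lemma orthogonal_idempotents_commute:
  fixes c d v :: "'a::jordan_algebra"
  assumes "c \<odot> c = c" "c \<odot> d = 0"
  shows "c \<odot> (d \<odot> v) = d \<odot> (c \<odot> v)"
  using jordan_linearized[of c c d v] assms
  by (simp add: jprod_commute[of d c] jprod.zero_left jprod.zero_right)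

text \<open>With M(z) denoting multiplication by z and Q the quadratic map, fact 1 is Q(a)M(b) =
  M(a) and fact 2 is Q(a)M(b^2) = 2 M(b)M(a) - I. Substituting Q(b) = 2 M(b)^2 - M(b^2) leaves the
  identity, since M(a) and M(b) commute.\<close>

lemma jquad_inverse:
  fixes a b v :: "'a::euclidean_jordan_algebra"
  assumes ab: "a \<odot> b = jone" and abb: "a \<odot> (b \<odot> b) = b"
    and comm: "\<And>z. b \<odot> (a \<odot> z) = a \<odot> (b \<odot> z)"
    and comm2: "\<And>z. (b \<odot> b) \<odot> (a \<odot> z) = a \<odot> ((b \<odot> b) \<odot> z)"
  shows "jquad a (jquad b v) = v"
proof -
  have 1: "2 *\<^sub>R (a \<odot> (a \<odot> (b \<odot> z))) - (a \<odot> a) \<odot> (b \<odot> z) = a \<odot> z" for z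
    using jprod_triple[of a a b z] ab
    by (simp add: jprod_commute[of b a] comm scaleR_2 algebra_simps)
  have 2: "2 *\<^sub>R (a \<odot> (a \<odot> ((b \<odot> b) \<odot> v))) - (a \<odot> a) \<odot> ((b \<odot> b) \<odot> v) = 2 *\<^sub>R (b \<odot> (a \<odot> v)) - v"
    using jprod_triple[of a a "b \<odot> b" v] ab
    by (simp add: abb jprod_commute[of "b \<odot> b" a] comm2 comm scaleR_2 algebra_simps)
  show ?thesis
    using 1[of "b \<odot> v"] 2
    by (simp add: jquad_def comm scaleR_2 jprod.add_right jprod.diff_right algebra_simps)
qed

section \<open>Peirce decomposition\<close>

text \<open>Multiplication by an idempotent is annihilated by 2t^3 - 3t^2 + t, whose roots 0, 1/2
  and 1 are simple.\<close>

lemma peirce_decomposition: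
  fixes c x :: "'a::jordan_algebra"
  assumes "c \<odot> c = c"
  obtains x1 xh x0 where "x = x1 + xh + x0" "c \<odot> x1 = x1" "c \<odot> xh = (1/2) *\<^sub>R xh" "c \<odot> x0 = 0"
proof -
  have cubic: "2 *\<^sub>R (c \<odot> (c \<odot> (c \<odot> x))) = 3 *\<^sub>R (c \<odot> (c \<odot> x)) - c \<odot> x"
    using jprod_triple[of c c c x] assms scaleR_left_distrib[of 2 1 "c \<odot> (c \<odot> x)"]
    by (simp add: scaleR_2 algebra_simps)
  define a where "a = c \<odot> x"
  define b where "b = c \<odot> a"
  have cb: "c \<odot> b = (3/2) *\<^sub>R b - (1/2) *\<^sub>R a"
  proof -
    have "c \<odot> b = (1/2) *\<^sub>R (2 *\<^sub>R (c \<odot> b))" by simp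
    also have "\<dots> = (1/2) *\<^sub>R (3 *\<^sub>R b - a)" using cubic by (simp only: a_def b_def)
    finally show ?thesis by (simp add: scaleR_diff_right)
  qed
  have mult: "2 *\<^sub>R z = z + z" "3 *\<^sub>R z = z + z + z" "4 *\<^sub>R z = z + z + z + z" for z :: 'a
    using scaleR_left_distrib[of 2 1 z] scaleR_left_distrib[of 2 2 z] by (simp_all add: scaleR_2)
  show thesis
  proof
    \<comment> \<open>The summands are the Lagrange polynomials 2t^2 - t, 4t - 4t^2 and 1 - 3t +
      2t^2 for the nodes 1, 1/2 and 0, applied to \<open>x\<close>.\<close>
    show "x = (2 *\<^sub>R b - a) + (4 *\<^sub>R a - 4 *\<^sub>R b) + (x - 3 *\<^sub>R a + 2 *\<^sub>R b)"
      unfolding mult by (simp only: algebra_simps)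
    show "c \<odot> (2 *\<^sub>R b - a) = 2 *\<^sub>R b - a"
      by (simp add: jprod.diff_right jprod.scaleR_right cb flip: b_def) (simp add: mult algebra_simps)
    show "c \<odot> (4 *\<^sub>R a - 4 *\<^sub>R b) = (1/2) *\<^sub>R (4 *\<^sub>R a - 4 *\<^sub>R b)"
      by (simp add: jprod.diff_right jprod.scaleR_right cb flip: b_def) (simp add: algebra_simps flip: scaleR_add_left)
    show "c \<odot> (x - 3 *\<^sub>R a + 2 *\<^sub>R b) = 0"
      by (simp add: jprod.diff_right jprod.add_right jprod.scaleR_right cb flip: b_def a_def) (simp add: algebra_simps flip: scaleR_add_left)
  qed
qed

text \<open>The linearized identity at \<open>c\<close>, \<open>c\<close>, \<open>x\<close> has the
  factor \<open>2 * \<alpha> - 1\<close> on both sides. For \<alpha> equal to 0 or 1 the result says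
  that multiplication by \<open>x\<close> preserves every Peirce space.\<close>

lemma peirce_mult:
  fixes c x y :: "'a::jordan_algebra"
  assumes "c \<odot> c = c" "c \<odot> x = \<alpha> *\<^sub>R x" "c \<odot> y = \<beta> *\<^sub>R y" "\<alpha> \<noteq> 1/2"
  shows "c \<odot> (x \<odot> y) = \<beta> *\<^sub>R (x \<odot> y)"
proof -
  have "(2 * \<alpha> - 1) *\<^sub>R (c \<odot> (x \<odot> y)) = (2 * \<alpha> - 1) *\<^sub>R (\<beta> *\<^sub>R (x \<odot> y))"
    using jordan_linearized[of c c x y] assms
    by (simp add: jprod_commute[of x c] jprod.scaleR_right jprod.scaleR_left algebra_simps scaleR_2)
       (simp add: algebra_simps flip: scaleR_2)
  then show ?thesis
    by (rule scaleR_left_imp_eq[rotated]) (use assms(4) in simp)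
qed

text \<open>The equation says that the product lies in the sum of the Peirce spaces for 0 and 1,
  which a reflection will fix pointwise.\<close>

lemma peirce_mult_half:
  fixes c x y :: "'a::jordan_algebra"
  assumes "c \<odot> c = c" "c \<odot> x = (1/2) *\<^sub>R x" "c \<odot> y = (1/2) *\<^sub>R y"
  shows "c \<odot> (c \<odot> (x \<odot> y)) = c \<odot> (x \<odot> y)"
  using jordan_linearized[of x y c c] assms
  by (simp add: jprod_commute[of x c] jprod_commute[of y c] jprod_commute[of "x \<odot> y" c] jprod_commute[of y x]
      jprod.scaleR_right jprod.scaleR_left algebra_simps)

text \<open>Each factor serves once as the multiplier in \<open>peirce_mult\<close>, so the product
  satisfies the eigenvalue equations for 0 and for 1.\<close>

lemma peirce_one_zero:
  fixes c x y :: "'a::jordan_algebra"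
  assumes "c \<odot> c = c" "c \<odot> x = x" "c \<odot> y = 0"
  shows "x \<odot> y = 0"
  using peirce_mult[of c x 1 y 0] peirce_mult[of c y 0 x 1] assms
  by (simp add: jprod_commute[of y x])

section \<open>The spectral theorem\<close>

text \<open>\<open>jprod_triple\<close> expresses multiplication by a power through multiplications
  by \<open>u\<close>, by \<open>u \<odot> u\<close> and by the two preceding powers. The induction
  therefore carries both claims, and the Jordan identity makes the first two multiplications
  commute.\<close>

lemma jpower_commute:
  fixes u v :: "'a::jordan_algebra"
  shows "u \<odot> (jpower u k \<odot> v) = jpower u k \<odot> (u \<odot> v)"
    and "(u \<odot> u) \<odot> (jpower u k \<odot> v) = jpower u k \<odot> ((u \<odot> u) \<odot> v)"
proof -
  have "\<forall>v. u \<odot> (jpower u k \<odot> v) = jpower u k \<odot> (u \<odot> v) \<and>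
          (u \<odot> u) \<odot> (jpower u k \<odot> v) = jpower u k \<odot> ((u \<odot> u) \<odot> v)"
  proof (induction k rule: less_induct)
    case (less k)
    show ?case
    proof (cases "k < 2")
      case True
      then have "k = 0 \<or> k = 1" by auto
      then show ?thesis by (auto simp: jordan_identity)
    next
      case False
      then obtain m where k: "k = Suc (Suc m)"
        by (metis One_nat_def less_2_cases_iff not0_implies_Suc)
      define p where "p = jpower u m"
      define q where "q = u \<odot> p"
      have p: "u \<odot> (p \<odot> z) = p \<odot> (u \<odot> z)" "(u \<odot> u) \<odot> (p \<odot> z) = p \<odot> ((u \<odot> u) \<odot> z)" for z
        using less.IH[of m] k by (auto simp: p_def)
      have q: "u \<odot> (q \<odot> z) = q \<odot> (u \<odot> z)" "(u \<odot> u) \<odot> (q \<odot> z) = q \<odot> ((u \<odot> u) \<odot> z)" for z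
        using less.IH[of "Suc m"] k by (auto simp: p_def q_def)
      have pow: "jpower u k \<odot> z
          = q \<odot> (u \<odot> z) + q \<odot> (u \<odot> z) + (u \<odot> u) \<odot> (p \<odot> z) - u \<odot> (u \<odot> (p \<odot> z)) - p \<odot> (u \<odot> (u \<odot> z))" for z
        using jprod_triple[of u u p z]
        by (simp add: k p_def[symmetric] jprod_commute[of p u]) (simp add: q_def)
      show ?thesis
        by (simp add: pow jprod.add_right jprod.diff_right p q jordan_identity)
    qed
  qed
  then show "u \<odot> (jpower u k \<odot> v) = jpower u k \<odot> (u \<odot> v)"
    and "(u \<odot> u) \<odot> (jpower u k \<odot> v) = jpower u k \<odot> ((u \<odot> u) \<odot> v)"
    by auto
qed

lemma jpower_add:
  fixes u :: "'a::jordan_algebra"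
  shows "jpower u m \<odot> jpower u n = jpower u (m + n)"
proof (induction m)
  case (Suc m)
  have "jpower u (Suc m) \<odot> jpower u n = u \<odot> (jpower u n \<odot> jpower u m)"
    by (simp add: jprod_commute[of "u \<odot> jpower u m"] jpower_commute(1))
  then show ?case
    using Suc by (simp add: jprod_commute[of "jpower u n"])
qed simp

text \<open>On powers this is \<open>jpower_add\<close>, and both sides are bilinear. It lets the
  eigenvalue of either factor pass to a product of eigenvectors.\<close>

lemma jprod_assoc_span_jpower:
  fixes u :: "'a::jordan_algebra"
  assumes "a \<in> span (range (jpower u))" "b \<in> span (range (jpower u))"
  shows "u \<odot> (a \<odot> b) = (u \<odot> a) \<odot> b"
  using assms(1)
proof (induction rule: span_induct_alt)
  case (step r p y)
  then obtain m where p: "p = jpower u m" by auto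
  have "u \<odot> (p \<odot> b) = (u \<odot> p) \<odot> b"
    using assms(2)
  proof (induction rule: span_induct_alt)
    case (step r' p' y')
    then obtain n where p': "p' = jpower u n" by auto
    have "u \<odot> (p \<odot> p') = (u \<odot> p) \<odot> p'"
      using jpower_add[of u m n] jpower_add[of u "Suc m" n] by (simp add: p p')
    then show ?case
      using step by (simp add: jprod.add_right jprod.scaleR_right)
  qed (simp add: jprod.zero_right)
  then show ?case
    using step by (simp add: jprod.add_left jprod.add_right jprod.scaleR_left jprod.scaleR_right)
qed (simp add: jprod.zero_left jprod.zero_right)

lemma jprod_span_jpower:
  fixes u :: "'a::jordan_algebra"
  assumes "a \<in> span (range (jpower u))"
  shows "u \<odot> a \<in> span (range (jpower u))"
  using assms
proof (induction rule: span_induct_alt)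
  case (step r p y)
  then obtain m where p: "p = jpower u m" by auto
  have "u \<odot> p \<in> span (range (jpower u))"
    by (metis p jpower.simps(2) rangeI span_base)
  then show ?case
    using step by (simp add: jprod.add_right jprod.scaleR_right span_add span_scale)
qed (simp add: jprod.zero_right span_zero)

section \<open>Diagonalization of self-adjoint operators\<close>

text \<open>The form \<open>B\<close> need not be the inner product of the type, so the eigenvector is found by
  maximizing the Rayleigh quotient of \<open>B\<close> over the unit sphere of the norm of the type.\<close>

lemma selfadjoint_eigenvector:
  fixes T :: "'a::euclidean_space \<Rightarrow> 'a" and B :: "'a \<Rightarrow> 'a \<Rightarrow> real"
  assumes B: "bilinear B" and sym: "\<And>x y. B x y = B y x" and pos: "\<And>x. x \<noteq> 0 \<Longrightarrow> B x x > 0"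
    and T: "linear T" and W: "subspace W" and inv: "\<And>x. x \<in> W \<Longrightarrow> T x \<in> W"
    and adj: "\<And>x y. x \<in> W \<Longrightarrow> y \<in> W \<Longrightarrow> B (T x) y = B x (T y)" and nz: "W \<noteq> {0}"
  obtains y \<kappa> where "y \<in> W" "y \<noteq> 0" "T y = \<kappa> *\<^sub>R y"
proof -
  interpret B: bounded_bilinear B
    using B bilinear_conv_bounded_bilinear by blast
  interpret T: bounded_linear T
    using T linear_conv_bounded_linear by blast
  define S where "S = W \<inter> sphere 0 1"
  have "compact S"
    using W by (simp add: S_def closed_subspace compact_Int_closed Int_commute closed_Int_compact)
  obtain z where z: "z \<in> W" "z \<noteq> 0"
    using nz subspace_0[OF W] by auto
  then have "z /\<^sub>R norm z \<in> S"
    using W by (simp add: S_def subspace_scale)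
  then have "S \<noteq> {}" by auto
  have nonzero: "x \<noteq> 0" if "x \<in> S" for x
    using that by (auto simp: S_def)
  have "continuous_on S (\<lambda>x. B (T x) x / B x x)"
    using nonzero pos
    by (intro continuous_intros B.continuous_on T.continuous_on) (auto simp: less_imp_neq[symmetric])
  then obtain y where y: "y \<in> S" and max: "\<And>x. x \<in> S \<Longrightarrow> B (T x) x / B x x \<le> B (T y) y / B y y"
    using continuous_attains_sup[OF \<open>compact S\<close> \<open>S \<noteq> {}\<close>] by blast
  define \<kappa> where "\<kappa> = B (T y) y / B y y"
  \<comment> \<open>By maximality \<open>g\<close> is positive semidefinite on \<open>W\<close>,
    with \<open>y\<close> as a null vector. Hence \<open>y\<close> pairs to zero with the residual
    \<open>z\<close>, while \<open>g y z = B z z\<close>.\<close>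
  define g where "g x x' = \<kappa> * B x x' - B (T x) x'" for x x'
  have yW: "y \<in> W" "y \<noteq> 0" using y nonzero by (auto simp: S_def)
  have "g x x \<ge> 0" if "x \<in> W" for x
  proof (cases "x = 0")
    case False
    have "x /\<^sub>R norm x \<in> S"
      using W that False by (simp add: S_def subspace_scale)
    from max[OF this] have "B (T x) x / B x x \<le> \<kappa>"
      using False by (simp add: \<kappa>_def T.scaleR B.scaleR_left B.scaleR_right)
    then show ?thesis
      using pos[OF False] by (simp add: g_def pos_divide_le_eq)
  qed (simp add: g_def B.zero_left B.zero_right)
  moreover have gyy: "g y y = 0"
    using pos[OF yW(2)] by (simp add: g_def \<kappa>_def)
  define z where "z = \<kappa> *\<^sub>R y - T y"
  have zW: "z \<in> W"
    using yW inv W by (simp add: z_def subspace_diff subspace_scale)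
  have expand: "g (y + t *\<^sub>R z) (y + t *\<^sub>R z) = 2 * t * g y z + t\<^sup>2 * g z z" for t
  proof -
    have "B (T z) y = B (T y) z"
      using adj[OF zW yW(1)] sym[of z "T y"] by simp
    then show ?thesis
      using gyy sym[of z y]
      by (simp add: g_def T.add T.scaleR B.add_left B.add_right B.scaleR_left B.scaleR_right
          algebra_simps power2_eq_square)
  qed
  have "g y z = 0"
  proof (rule ccontr)
    assume ne: "g y z \<noteq> 0"
    have quad: "0 \<le> 2 * t * g y z + t\<^sup>2 * g z z" for t
      using calculation[of "y + t *\<^sub>R z"] expand[of t] yW zW W
      by (simp add: subspace_add subspace_scale)
    define k where "k = g z z"
    have k: "k \<ge> 0" using calculation[OF zW] by (simp add: k_def)
    \<comment> \<open>This \<open>t\<close> minimizes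
      \<open>2 * t * g y z + t\<^sup>2 * (k + 1)\<close>; adding 1 keeps the denominator nonzero
      when \<open>k = 0\<close>.\<close>
    have "0 \<le> 2 * (- g y z / (k + 1)) * g y z + (- g y z / (k + 1))\<^sup>2 * k"
      using quad[of "- g y z / (k + 1)"] by (simp add: k_def)
    also have "\<dots> = (g y z)\<^sup>2 * (- k - 2) / (k + 1)\<^sup>2"
      using k by (simp add: field_simps power2_eq_square add_nonneg_eq_0_iff)
    also have "\<dots> < 0"
      using ne k by (intro divide_neg_pos mult_pos_neg) auto
    finally show False by simp
  qed
  moreover have "g y z = B z z"
    by (simp add: g_def z_def B.diff_left B.scaleR_left)
  ultimately have "z = 0"
    using pos[of z] by force
  then show thesis
    using that[of y \<kappa>] yW by (simp add: z_def)
qed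

text \<open>Induction on the dimension: by self-adjointness, the \<open>B\<close>-orthogonal
  complement of an eigenvector inside \<open>W\<close> is again invariant.\<close>

lemma selfadjoint_span_eigenvectors:
  fixes T :: "'a::euclidean_space \<Rightarrow> 'a" and B :: "'a \<Rightarrow> 'a \<Rightarrow> real"
  assumes B: "bilinear B" and sym: "\<And>x y. B x y = B y x" and pos: "\<And>x. x \<noteq> 0 \<Longrightarrow> B x x > 0"
    and T: "linear T" and "subspace W" and "\<And>x. x \<in> W \<Longrightarrow> T x \<in> W"
    and "\<And>x y. x \<in> W \<Longrightarrow> y \<in> W \<Longrightarrow> B (T x) y = B x (T y)"
  shows "W \<subseteq> span {y \<in> W. \<exists>\<kappa>. T y = \<kappa> *\<^sub>R y}"
  using assms(5-7)
proof (induction "dim W" arbitrary: W rule: less_induct)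
  case less
  note W = less.prems(1) and inv = less.prems(2) and adj = less.prems(3)
  show ?case
  proof (cases "W = {0}")
    case False
    obtain y \<kappa> where y: "y \<in> W" "y \<noteq> 0" "T y = \<kappa> *\<^sub>R y"
      using selfadjoint_eigenvector[OF B sym pos T W inv adj False] by blast
    define W' where "W' = {w \<in> W. B w y = 0}"
    have W': "subspace W'"
      using W by (auto simp: W'_def subspace_def bilinear_ladd[OF B] bilinear_lmul[OF B] bilinear_lzero[OF B])
    have "W' \<subset> W"
      using y pos[of y] by (force simp: W'_def)
    then have "dim W' < dim W"
      using W W' by (intro dim_psubset) (simp add: span_eq_iff[THEN iffD2])
    moreover have "T x \<in> W'" if "x \<in> W'" for x
      using that inv adj[of x y] y by (auto simp: W'_def bilinear_rmul[OF B])
    ultimately have W'_span: "W' \<subseteq> span {y \<in> W'. \<exists>\<kappa>. T y = \<kappa> *\<^sub>R y}"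
      using W' adj by (intro less.hyps) (auto simp: W'_def)
    have sub: "span {y \<in> W'. \<exists>\<kappa>. T y = \<kappa> *\<^sub>R y} \<subseteq> span {y \<in> W. \<exists>\<kappa>. T y = \<kappa> *\<^sub>R y}"
      by (rule span_mono) (auto simp: W'_def)
    show ?thesis
    proof
      fix w assume w: "w \<in> W"
      define r where "r = B w y / B y y"
      have "w - r *\<^sub>R y \<in> W'"
        using w y W pos[of y]
        by (simp add: W'_def r_def subspace_diff subspace_scale bilinear_lsub[OF B] bilinear_lmul[OF B])
      then have "w - r *\<^sub>R y \<in> span {y \<in> W. \<exists>\<kappa>. T y = \<kappa> *\<^sub>R y}"
        using W'_span sub by blast
      moreover have "r *\<^sub>R y \<in> span {y \<in> W. \<exists>\<kappa>. T y = \<kappa> *\<^sub>R y}"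
        using y by (intro span_scale span_base) auto
      ultimately show "w \<in> span {y \<in> W. \<exists>\<kappa>. T y = \<kappa> *\<^sub>R y}"
        using span_add[of "w - r *\<^sub>R y" _ "r *\<^sub>R y"] by simp
    qed
  qed (simp add: span_zero)
qed

text \<open>Indexing by the eigenvalue merges eigenvectors with a common eigenvalue, so that
  distinct components have distinct eigenvalues.\<close>

lemma span_eigenvectors_sum:
  fixes T :: "'a::real_vector \<Rightarrow> 'a"
  assumes T: "linear T" and W: "subspace W" and x: "x \<in> span {y \<in> W. \<exists>\<kappa>. T y = \<kappa> *\<^sub>R y}"
  shows "\<exists>f. finite {\<kappa>. f \<kappa> \<noteq> 0} \<and> (\<forall>\<kappa>. f \<kappa> \<in> W \<and> T (f \<kappa>) = \<kappa> *\<^sub>R f \<kappa>) \<and> x = (\<Sum>\<kappa> | f \<kappa> \<noteq> 0. f \<kappa>)"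
  using x
proof (induction rule: span_induct_alt)
  case base
  show ?case
    using W by (intro exI[of _ "\<lambda>_. 0"]) (auto simp: subspace_0 linear_0[OF T])
next
  case (step r y x)
  then obtain f \<mu> where f: "finite {\<kappa>. f \<kappa> \<noteq> 0}" "\<And>\<kappa>. f \<kappa> \<in> W" "\<And>\<kappa>. T (f \<kappa>) = \<kappa> *\<^sub>R f \<kappa>"
      "x = (\<Sum>\<kappa> | f \<kappa> \<noteq> 0. f \<kappa>)" and y: "y \<in> W" "T y = \<mu> *\<^sub>R y"
    by auto
  define g where "g = f(\<mu> := r *\<^sub>R y + f \<mu>)"
  define A where "A = insert \<mu> {\<kappa>. f \<kappa> \<noteq> 0}"
  have A: "finite A" "\<mu> \<in> A" "{\<kappa>. g \<kappa> \<noteq> 0} \<subseteq> A" "{\<kappa>. f \<kappa> \<noteq> 0} \<subseteq> A"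
    using f(1) by (auto simp: A_def g_def)
  have "(\<Sum>\<kappa> | g \<kappa> \<noteq> 0. g \<kappa>) = sum g A"
    using A by (intro sum.mono_neutral_left) auto
  also have "\<dots> = r *\<^sub>R y + sum f A"
    using A by (simp add: sum.remove[of A \<mu>] g_def)
  also have "sum f A = x"
    unfolding f(4) using A by (intro sum.mono_neutral_right) auto
  finally have "r *\<^sub>R y + x = (\<Sum>\<kappa> | g \<kappa> \<noteq> 0. g \<kappa>)" by simp
  moreover have "finite {\<kappa>. g \<kappa> \<noteq> 0}"
    using A finite_subset by blast
  moreover have "g \<kappa> \<in> W \<and> T (g \<kappa>) = \<kappa> *\<^sub>R g \<kappa>" for \<kappa>
    using f y W by (auto simp: g_def subspace_add subspace_scale linear_add[OF T] linear_scale[OF T] algebra_simps)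
  ultimately show ?case
    by blast
qed

text \<open>A Jordan frame with primitivity relaxed to being nonzero. The eigenspaces of an element
  yield such a system, which is later refined to a frame.\<close>

definition idempotent_system :: "'a::jordan_algebra set \<Rightarrow> bool" where
  "idempotent_system C \<longleftrightarrow>
     finite C \<and> (\<forall>c\<in>C. c \<noteq> 0 \<and> c \<odot> c = c) \<and>
     (\<forall>c\<in>C. \<forall>c'\<in>C. c \<noteq> c' \<longrightarrow> c \<odot> c' = 0) \<and> (\<Sum>c\<in>C. c) = jone"

lemma idempotent_system_sum_mult:
  assumes C: "idempotent_system C"
  shows "(\<Sum>c\<in>C. a c *\<^sub>R c) \<odot> (\<Sum>c\<in>C. b c *\<^sub>R c) = (\<Sum>c\<in>C. (a c * b c) *\<^sub>R c)"
proof -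
  have "(a c *\<^sub>R c) \<odot> (\<Sum>c\<in>C. b c *\<^sub>R c) = (a c * b c) *\<^sub>R c" if "c \<in> C" for c
  proof -
    have "(a c *\<^sub>R c) \<odot> (\<Sum>c\<in>C. b c *\<^sub>R c) = (\<Sum>c'\<in>C. if c' = c then (a c * b c) *\<^sub>R c else 0)"
      unfolding jprod.sum_right
      by (rule sum.cong)
        (use C that in \<open>auto simp: idempotent_system_def jprod.scaleR_right jprod.scaleR_left\<close>)
    then show ?thesis
      using C that by (simp add: idempotent_system_def)
  qed
  then show ?thesis
    by (simp add: jprod.sum_left)
qed

text \<open>Multiplying a linear relation by one member isolates its coefficient. The dimension then
  bounds the size of a system.\<close>

lemma idempotent_system_independent:
  fixes C :: "'a::jordan_algebra set"
  assumes "idempotent_system C"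
  shows "independent C"
proof
  have C: "finite C" "\<And>c. c \<in> C \<Longrightarrow> c \<noteq> 0 \<and> c \<odot> c = c"
    "\<And>c c'. c \<in> C \<Longrightarrow> c' \<in> C \<Longrightarrow> c \<noteq> c' \<Longrightarrow> c \<odot> c' = 0"
    using assms by (auto simp: idempotent_system_def)
  assume "dependent C"
  then obtain r c where rc: "c \<in> C" "r c \<noteq> 0" "(\<Sum>c\<in>C. r c *\<^sub>R c) = 0"
    using dependent_finite[OF C(1)] by auto
  have "0 = c \<odot> (\<Sum>c\<in>C. r c *\<^sub>R c)"
    by (simp add: rc jprod.zero_right)
  also have "\<dots> = (\<Sum>c'\<in>C. if c' = c then r c *\<^sub>R c else 0)"
    unfolding jprod.sum_right
    by (rule sum.cong) (use C rc in \<open>auto simp: jprod.scaleR_right\<close>)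
  also have "\<dots> = r c *\<^sub>R c"
    using C rc by simp
  finally show False
    using rc C by simp
qed

text \<open>Multiplication by \<open>u\<close> is self-adjoint for the associative form
  \<open>B\<close>, hence diagonalizable on the span of the powers of \<open>u\<close>. The
  idempotents are the components of \<open>jone\<close> in the eigenspaces.\<close>

lemma idempotent_system_exists:
  fixes u :: "'a::euclidean_jordan_algebra"
  shows "\<exists>C l. idempotent_system C \<and> u = (\<Sum>c\<in>C. l c *\<^sub>R c)"
proof -
  obtain B :: "'a \<Rightarrow> 'a \<Rightarrow> real" where
    B: "\<And>u v w. B (u + v) w = B u w + B v w" "\<And>r u v. B (r *\<^sub>R u) v = r * B u v"
    and sym: "\<And>u v. B u v = B v u" and pos: "\<And>u. u \<noteq> 0 \<Longrightarrow> B u u > 0"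
    and assoc: "\<And>u v w. B (u \<odot> v) w = B v (u \<odot> w)"
    using ex_associative_inner by (elim exE conjE) blast
  have bil: "bilinear B"
    unfolding bilinear_def by (auto intro!: linearI simp: B) (metis B sym)+
  define W where "W = span (range (jpower u))"
  have lin: "linear ((\<odot>) u)"
    by (auto intro!: linearI simp: jprod.add_right jprod.scaleR_right)
  have "W \<subseteq> span {y \<in> W. \<exists>\<kappa>. u \<odot> y = \<kappa> *\<^sub>R y}"
    by (rule selfadjoint_span_eigenvectors[OF bil sym pos lin])
      (auto simp: W_def jprod_span_jpower assoc)
  moreover have "jone \<in> W"
    unfolding W_def by (metis jpower.simps(1) rangeI span_base)
  ultimately obtain f where fin: "finite {\<kappa>. f \<kappa> \<noteq> 0}" and fW: "\<And>\<kappa>. f \<kappa> \<in> W"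
    and ev: "\<And>\<kappa>. u \<odot> f \<kappa> = \<kappa> *\<^sub>R f \<kappa>" and one: "jone = (\<Sum>\<kappa> | f \<kappa> \<noteq> 0. f \<kappa>)"
    using span_eigenvectors_sum[OF lin, of W jone] by (auto simp: W_def)
  have orth: "f \<kappa> \<odot> f \<nu> = 0" if "\<kappa> \<noteq> \<nu>" for \<kappa> \<nu>
  proof -
    have "\<kappa> *\<^sub>R (f \<kappa> \<odot> f \<nu>) = u \<odot> (f \<kappa> \<odot> f \<nu>)"
      using jprod_assoc_span_jpower[of "f \<kappa>" u "f \<nu>"] fW ev by (simp add: W_def jprod.scaleR_left)
    also have "\<dots> = \<nu> *\<^sub>R (f \<kappa> \<odot> f \<nu>)"
      using jprod_assoc_span_jpower[of "f \<nu>" u "f \<kappa>"] fW ev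
      by (simp add: W_def jprod.scaleR_left jprod_commute[of "f \<nu>"])
    finally show ?thesis
      using that by simp
  qed
  have idem: "f \<kappa> \<odot> f \<kappa> = f \<kappa>" if "f \<kappa> \<noteq> 0" for \<kappa>
  proof -
    have "f \<kappa> = f \<kappa> \<odot> (\<Sum>\<kappa> | f \<kappa> \<noteq> 0. f \<kappa>)"
      by (simp flip: one)
    also have "\<dots> = (\<Sum>\<nu> | f \<nu> \<noteq> 0. if \<nu> = \<kappa> then f \<kappa> \<odot> f \<kappa> else 0)"
      unfolding jprod.sum_right by (rule sum.cong) (auto simp: orth)
    also have "\<dots> = f \<kappa> \<odot> f \<kappa>"
      using that fin by simp
    finally show ?thesis by simp
  qed
  define K where "K = {\<kappa>. f \<kappa> \<noteq> 0}"
  have inj: "inj_on f K"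
    by (rule inj_onI) (metis (mono_tags, lifting) K_def idem mem_Collect_eq orth)
  have "idempotent_system (f ` K)"
    unfolding idempotent_system_def
    using fin idem orth one inj by (auto simp: K_def sum.reindex[OF inj[unfolded K_def]]) (metis orth)
  moreover have "u = (\<Sum>c\<in>f ` K. inv_into K f c *\<^sub>R c)"
  proof -
    have "u = u \<odot> jone" by simp
    also have "\<dots> = (\<Sum>\<kappa>\<in>K. \<kappa> *\<^sub>R f \<kappa>)"
      by (subst one) (simp add: K_def jprod.sum_right ev)
    also have "\<dots> = (\<Sum>c\<in>f ` K. inv_into K f c *\<^sub>R c)"
      by (simp add: sum.reindex[OF inj] inv_into_f_f[OF inj])
    finally show ?thesis .
  qed
  ultimately show ?thesis
    by blast
qed

lemma jordan_frame_idempotent_system: "jordan_frame C \<Longrightarrow> idempotent_system C"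
  by (auto simp: jordan_frame_def idempotent_system_def primitive_idempotent_def)

text \<open>An idempotent system of maximal cardinality consists of primitive idempotents, since any
  other member could be split in two.\<close>

theorem spectral_decomposition_exists:
  fixes u :: "'a::euclidean_jordan_algebra"
  shows "\<exists>C l. spectral_decomposition u C l"
proof -
  define P where "P C \<longleftrightarrow> idempotent_system C \<and> (\<exists>l. u = (\<Sum>c\<in>C. l c *\<^sub>R c))" for C
  obtain C0 where "P C0"
    using idempotent_system_exists[of u] by (auto simp: P_def)
  moreover have "\<forall>C. P C \<longrightarrow> card C \<le> DIM('a)"
    using idempotent_system_independent independent_bound by (auto simp: P_def)
  ultimately obtain C where "P C" and max: "\<And>C'. P C' \<Longrightarrow> card C' \<le> card C"
    using ex_has_greatest_nat[of P C0 card "Suc DIM('a)"] by (auto simp: less_Suc_eq_le)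
  then obtain l where u: "u = (\<Sum>c\<in>C. l c *\<^sub>R c)" and sys: "idempotent_system C"
    by (auto simp: P_def)
  then have C: "finite C" "\<And>c. c \<in> C \<Longrightarrow> c \<noteq> 0 \<and> c \<odot> c = c"
    "\<And>c c'. c \<in> C \<Longrightarrow> c' \<in> C \<Longrightarrow> c \<noteq> c' \<Longrightarrow> c \<odot> c' = 0" "\<Sum>C = jone"
    by (auto simp: idempotent_system_def)
  have "primitive_idempotent c" if c: "c \<in> C" for c
  proof (rule ccontr)
    assume "\<not> primitive_idempotent c"
    then obtain a b where ab: "a \<noteq> 0" "b \<noteq> 0" "a \<odot> a = a" "b \<odot> b = b" "a \<odot> b = 0" and cab: "c = a + b"
      using C(2)[OF c] by (auto simp: primitive_idempotent_def)
    have ba: "b \<odot> a = 0" using ab(5) by (metis jprod_commute)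
    have ca: "c \<odot> a = a" "c \<odot> b = b"
      using ab ba by (auto simp: cab jprod.add_left)
    \<comment> \<open>\<open>a\<close> and \<open>b\<close> lie in the Peirce space of
      \<open>c\<close> for 1, and \<open>c'\<close> in the one for 0.\<close>
    have orth: "a \<odot> c' = 0" "b \<odot> c' = 0" "c' \<odot> a = 0" "c' \<odot> b = 0" if "c' \<in> C - {c}" for c'
      using peirce_one_zero[of c a c'] peirce_one_zero[of c b c'] ca C(2)[OF c] C(3)[OF c, of c'] that
      by (auto simp: jprod_commute[of c'])
    have new: "a \<notin> C - {c}" "b \<notin> C - {c}" "a \<noteq> b"
      using orth ab by metis+
    define C' where "C' = insert a (insert b (C - {c}))"
    have sum: "(\<Sum>c'\<in>C'. h c') = h a + h b + (\<Sum>c'\<in>C - {c}. h c')" for h :: "'a \<Rightarrow> 'a"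
      using new C(1) by (simp add: C'_def add.assoc)
    have "jone = a + b + \<Sum>(C - {c})"
      using sum.remove[OF C(1) c, of "\<lambda>c. c"] C(4) by (simp add: cab)
    then have "idempotent_system C'"
      unfolding idempotent_system_def sum
      using C ab ba orth by (auto simp: C'_def)
    moreover have "u = (\<Sum>c'\<in>C'. (l(a := l c, b := l c)) c' *\<^sub>R c')"
    proof -
      have "(\<Sum>c'\<in>C - {c}. (l(a := l c, b := l c)) c' *\<^sub>R c') = (\<Sum>c'\<in>C - {c}. l c' *\<^sub>R c')"
        using new by (intro sum.cong) auto
      then show ?thesis
        unfolding sum using new(3) sum.remove[OF C(1) c, of "\<lambda>c. l c *\<^sub>R c"]
        by (simp add: u cab scaleR_add_right)
    qed
    ultimately have "P C'"
      unfolding P_def by blast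
    moreover have "card C' = Suc (card C)"
      using new C(1) card.remove[OF C(1) c] by (simp add: C'_def)
    ultimately show False
      using max[of C'] by simp
  qed
  then have "spectral_decomposition u C l"
    using C u by (simp add: spectral_decomposition_def jordan_frame_def)
  then show ?thesis by blast
qed

section \<open>Independence of the functional calculus from the frame\<close>

lemma interpolating_polynomial:
  fixes f :: "real \<Rightarrow> real"
  assumes "finite S"
  shows "\<exists>p. \<forall>x\<in>S. poly p x = f x"
  using assms
proof (induction S)
  case (insert a S)
  then obtain p where p: "\<forall>x\<in>S. poly p x = f x" by blast
  define q where "q = (\<Prod>s\<in>S. [:- s, 1:])"
  have q: "poly q a \<noteq> 0" "\<forall>x\<in>S. poly q x = 0"
    using insert.hyps by (auto simp: q_def poly_prod)
  have "\<forall>x\<in>insert a S. poly (p + smult ((f a - poly p a) / poly q a) q) x = f x"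
    using p q by auto
  then show ?case by blast
qed simp

text \<open>On the finitely many eigenvalues of two decompositions \<open>f\<close> agrees with one
  polynomial. By Horner recursion the sum for a polynomial depends on \<open>u\<close> alone, so the
  description in \<open>jspectral\<close> is unique.\<close>

lemma jspectral_eq:
  assumes dec: "spectral_decomposition u C l"
  shows "jspectral f u = (\<Sum>c\<in>C. f (l c) *\<^sub>R c)"
proof -
  have unique: "(\<Sum>c\<in>D. f (m c) *\<^sub>R c) = (\<Sum>c\<in>C. f (l c) *\<^sub>R c)" if dec': "spectral_decomposition u D m" for D m
  proof -
    have fin: "finite (l ` C \<union> m ` D)"
      using dec dec' by (auto simp: spectral_decomposition_def jordan_frame_def)
    obtain p where p: "\<forall>x\<in>l ` C \<union> m ` D. poly p x = f x"
      using interpolating_polynomial[OF fin] by blast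
    have step: "(\<Sum>c\<in>E. poly (pCons a q) (k c) *\<^sub>R c) = a *\<^sub>R jone + u \<odot> (\<Sum>c\<in>E. poly q (k c) *\<^sub>R c)"
      if "spectral_decomposition u E k" for E k a q
    proof -
      have E: "idempotent_system E" "u = (\<Sum>c\<in>E. k c *\<^sub>R c)" "jone = \<Sum>E"
        using that jordan_frame_idempotent_system
        by (auto simp: spectral_decomposition_def jordan_frame_def)
      show ?thesis
        by (subst E(2), subst idempotent_system_sum_mult[OF E(1)])
          (simp add: E(3) scaleR_add_left sum.distrib scaleR_sum_right)
    qed
    have "(\<Sum>c\<in>D. poly p (m c) *\<^sub>R c) = (\<Sum>c\<in>C. poly p (l c) *\<^sub>R c)"
      by (induction p) (simp_all add: step[OF dec] step[OF dec'] del: poly_pCons)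
    then show ?thesis
      using p by simp
  qed
  show ?thesis
    unfolding jspectral_def
  proof (rule the_equality)
    show "\<exists>D m. spectral_decomposition u D m \<and> (\<Sum>c\<in>C. f (l c) *\<^sub>R c) = (\<Sum>c\<in>D. f (m c) *\<^sub>R c)"
      using dec by blast
  qed (use unique in blast)
qed

section \<open>Associativity of the trace form\<close>

lemma spectral_decomposition_automorphism:
  fixes \<phi> :: "'a::jordan_algebra \<Rightarrow> 'a"
  assumes lin: "linear \<phi>" and inv: "\<And>x. \<phi> (\<phi> x) = x" and mult: "\<And>x y. \<phi> (x \<odot> y) = \<phi> x \<odot> \<phi> y"
    and dec: "spectral_decomposition u C l"
  shows "spectral_decomposition (\<phi> u) (\<phi> ` C) (l \<circ> \<phi>)"
    and "(\<Sum>c\<in>\<phi> ` C. (l \<circ> \<phi>) c) = (\<Sum>c\<in>C. l c)"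
proof -
  have inj: "inj_on \<phi> C"
    by (metis inv inj_onI)
  have zero: "\<phi> x = 0 \<longleftrightarrow> x = 0" for x
    by (metis inv lin linear_0)
  have one: "\<phi> jone = jone"
    by (metis inv jone_left jone_right mult)
  have prim: "primitive_idempotent (\<phi> c)" if c: "primitive_idempotent c" for c
    unfolding primitive_idempotent_def
  proof (intro conjI notI)
    show "\<phi> c = 0 \<Longrightarrow> False" "\<phi> c \<odot> \<phi> c = \<phi> c"
      using c zero by (auto simp: primitive_idempotent_def simp flip: mult)
    assume "\<exists>a b. a \<noteq> 0 \<and> b \<noteq> 0 \<and> a \<odot> a = a \<and> b \<odot> b = b \<and> a \<odot> b = 0 \<and> \<phi> c = a + b"
    then obtain a b where ab: "a \<noteq> 0" "b \<noteq> 0" "a \<odot> a = a" "b \<odot> b = b" "a \<odot> b = 0" "\<phi> c = a + b"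
      by blast
    have "c = \<phi> a + \<phi> b"
      by (metis ab(6) inv lin linear_add)
    then show False
      using c ab zero linear_0[OF lin] unfolding primitive_idempotent_def by (metis mult)
  qed
  have C: "jordan_frame C" "u = (\<Sum>c\<in>C. l c *\<^sub>R c)"
    using dec by (auto simp: spectral_decomposition_def)
  have "jordan_frame (\<phi> ` C)"
    unfolding jordan_frame_def
  proof (intro conjI ballI impI)
    show "finite (\<phi> ` C)" using C by (simp add: jordan_frame_def)
    show "primitive_idempotent c" if "c \<in> \<phi> ` C" for c
      using that C prim by (auto simp: jordan_frame_def)
    show "c \<odot> c' = 0" if "c \<in> \<phi> ` C" "c' \<in> \<phi> ` C" "c \<noteq> c'" for c c'
      using that C linear_0[OF lin] by (auto simp: jordan_frame_def mult[symmetric]) metis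
    show "\<Sum>(\<phi> ` C) = jone"
      using C one by (simp add: sum.reindex[OF inj] jordan_frame_def o_def flip: linear_sum[OF lin])
  qed
  then show "spectral_decomposition (\<phi> u) (\<phi> ` C) (l \<circ> \<phi>)"
    by (simp add: spectral_decomposition_def C(2) sum.reindex[OF inj] inv linear_sum[OF lin] linear_scale[OF lin])
  show "(\<Sum>c\<in>\<phi> ` C. (l \<circ> \<phi>) c) = (\<Sum>c\<in>C. l c)"
    by (simp add: sum.reindex[OF inj] inv)
qed

lemma jtrace_automorphism:
  fixes \<phi> :: "'a::jordan_algebra \<Rightarrow> 'a"
  assumes "linear \<phi>" and inv: "\<And>x. \<phi> (\<phi> x) = x" and "\<And>x y. \<phi> (x \<odot> y) = \<phi> x \<odot> \<phi> y"
  shows "jtrace (\<phi> u) = jtrace u"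
proof -
  note aut = spectral_decomposition_automorphism[OF assms]
  have "(\<exists>C l. spectral_decomposition (\<phi> u) C l \<and> t = (\<Sum>c\<in>C. l c)) \<longleftrightarrow>
        (\<exists>C l. spectral_decomposition u C l \<and> t = (\<Sum>c\<in>C. l c))" for t
    using aut[of "\<phi> u"] aut[of u] unfolding inv by metis
  then show ?thesis
    by (simp add: jtrace_def)
qed

text \<open>Both \<open>u \<bullet> v\<close> and \<open>0 \<bullet> 0\<close> equal
  \<open>jtrace 0\<close>.\<close>

lemma inner_eq_zero_if_jprod_eq_zero:
  fixes u v :: "'a::euclidean_jordan_algebra"
  assumes "u \<odot> v = 0"
  shows "u \<bullet> v = 0"
  using inner_eq_jtrace[of u v] inner_eq_jtrace[of 0 "0 :: 'a"] assms by (simp add: jprod.zero_left)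

text \<open>The reflection \<open>P\<close> is the quadratic map of \<open>2c - e\<close>. As an automorphism it preserves the
  trace form, so its eigenspaces, the sum of the Peirce spaces for 0 and 1 and the Peirce space for
  1/2, are orthogonal.\<close>

lemma idempotent_selfadjoint:
  fixes c x y :: "'a::euclidean_jordan_algebra"
  assumes c: "c \<odot> c = c"
  shows "(c \<odot> x) \<bullet> y = x \<bullet> (c \<odot> y)"
proof -
  \<comment> \<open>The polynomial 1 - 8t + 8t^2 is 1 at t = 0 and t = 1, and -1 at t = 1/2.\<close>
  define P where "P z = z - 8 *\<^sub>R (c \<odot> z) + 8 *\<^sub>R (c \<odot> (c \<odot> z))" for z
  have lin: "linear P"
    by (rule linearI) (simp_all add: P_def jprod.add_right jprod.scaleR_right algebra_simps)
  have P1: "P z = z" if "c \<odot> (c \<odot> z) = c \<odot> z" for z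
    using that by (simp add: P_def)
  have Ph: "P z = - z" if "c \<odot> z = (1/2) *\<^sub>R z" for z
    using scaleR_left_distrib[of 2 2 z] that by (simp add: P_def jprod.scaleR_right scaleR_2 algebra_simps)
  \<comment> \<open>The Peirce rules are a parity grading, with the spaces for 0 and 1 even and that
    for 1/2 odd. \<open>P\<close> acts by the sign of the parity.\<close>
  have mult: "P (a \<odot> b) = P a \<odot> P b" for a b
  proof -
    obtain a1 ah a0 where a: "a = a1 + ah + a0" "c \<odot> a1 = a1" "c \<odot> ah = (1/2) *\<^sub>R ah" "c \<odot> a0 = 0"
      by (rule peirce_decomposition[OF c])
    obtain b1 bh b0 where b: "b = b1 + bh + b0" "c \<odot> b1 = b1" "c \<odot> bh = (1/2) *\<^sub>R bh" "c \<odot> b0 = 0"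
      by (rule peirce_decomposition[OF c])
    have Pa: "P a1 = a1" "P a0 = a0" "P ah = - ah" and Pb: "P b1 = b1" "P b0 = b0" "P bh = - bh"
      using a b by (auto intro!: P1 Ph simp: jprod.zero_right)
    have "c \<odot> (a1 \<odot> b1) = a1 \<odot> b1" "c \<odot> (a1 \<odot> bh) = (1/2) *\<^sub>R (a1 \<odot> bh)" "c \<odot> (a0 \<odot> b0) = 0"
      "c \<odot> (a0 \<odot> bh) = (1/2) *\<^sub>R (a0 \<odot> bh)" "a1 \<odot> b0 = 0"
      using peirce_mult[OF c, of a1 1 b1 1] peirce_mult[OF c, of a1 1 bh "1/2"]
        peirce_mult[OF c, of a0 0 b0 0] peirce_mult[OF c, of a0 0 bh "1/2"] peirce_one_zero[OF c] a b
      by simp_all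
    moreover have "c \<odot> (ah \<odot> b1) = (1/2) *\<^sub>R (ah \<odot> b1)" "c \<odot> (ah \<odot> b0) = (1/2) *\<^sub>R (ah \<odot> b0)"
      "a0 \<odot> b1 = 0"
      using peirce_mult[OF c, of b1 1 ah "1/2"] peirce_mult[OF c, of b0 0 ah "1/2"]
        peirce_one_zero[OF c, of b1 a0] a b
      by (simp_all add: jprod_commute[of b1] jprod_commute[of b0])
    moreover have "c \<odot> (c \<odot> (ah \<odot> bh)) = c \<odot> (ah \<odot> bh)"
      using peirce_mult_half[OF c] a b by simp
    ultimately show ?thesis
      by (simp add: a(1) b(1) linear_add[OF lin] Pa Pb P1 Ph jprod.add_left jprod.add_right
          jprod.minus_left jprod.minus_right jprod.diff_left jprod.diff_right
          linear_0[OF lin] jprod.zero_right)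
  qed
  have inv: "P (P z) = z" for z
  proof -
    obtain a1 ah a0 where a: "z = a1 + ah + a0" "c \<odot> a1 = a1" "c \<odot> ah = (1/2) *\<^sub>R ah" "c \<odot> a0 = 0"
      by (rule peirce_decomposition[OF c])
    then show ?thesis
      by (simp add: linear_add[OF lin] linear_diff[OF lin] P1 Ph jprod.zero_right)
  qed
  have isom: "P a \<bullet> P b = a \<bullet> b" for a b
    by (simp add: inner_eq_jtrace jtrace_automorphism[OF lin inv mult] flip: mult)
  obtain a1 ah a0 where a: "x = a1 + ah + a0" "c \<odot> a1 = a1" "c \<odot> ah = (1/2) *\<^sub>R ah" "c \<odot> a0 = 0"
    by (rule peirce_decomposition[OF c])
  obtain b1 bh b0 where b: "y = b1 + bh + b0" "c \<odot> b1 = b1" "c \<odot> bh = (1/2) *\<^sub>R bh" "c \<odot> b0 = 0"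
    by (rule peirce_decomposition[OF c])
  \<comment> \<open>In each pair \<open>P\<close> fixes one vector and negates the other, so the
    isometry equates the inner product with its negative.\<close>
  have "a1 \<bullet> bh = 0" "a0 \<bullet> bh = 0" "ah \<bullet> b1 = 0" "ah \<bullet> b0 = 0"
    using isom[of a1 bh] isom[of a0 bh] isom[of ah b1] isom[of ah b0] a b
    by (simp_all add: P1 Ph jprod.zero_right)
  moreover have "a1 \<bullet> b0 = 0" "a0 \<bullet> b1 = 0"
    using peirce_one_zero[OF c, of a1 b0] peirce_one_zero[OF c, of b1 a0] a b
    by (auto intro!: inner_eq_zero_if_jprod_eq_zero simp: jprod_commute[of a0])
  ultimately show ?thesis
    using a b by (simp add: jprod.add_right inner_add_left inner_add_right)
qed

section \<open>The quadratic representation on a frame\<close>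

lemma spectral_decomposition_idempotent_system:
  "spectral_decomposition u C l \<Longrightarrow> idempotent_system C"
  by (simp add: spectral_decomposition_def jordan_frame_idempotent_system)

lemma idempotent_system_sum_commute:
  assumes C: "idempotent_system C"
  shows "(\<Sum>c\<in>C. a c *\<^sub>R c) \<odot> ((\<Sum>c\<in>C. b c *\<^sub>R c) \<odot> z)
       = (\<Sum>c\<in>C. b c *\<^sub>R c) \<odot> ((\<Sum>c\<in>C. a c *\<^sub>R c) \<odot> z)"
proof -
  have comm: "c \<odot> (c' \<odot> z) = c' \<odot> (c \<odot> z)" if "c \<in> C" "c' \<in> C" for c c'
    using C that orthogonal_idempotents_commute[of c c' z]
    by (cases "c = c'") (auto simp: idempotent_system_def)
  have "(\<Sum>c\<in>C. a c *\<^sub>R c) \<odot> ((\<Sum>c'\<in>C. b c' *\<^sub>R c') \<odot> z)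
      = (\<Sum>c\<in>C. \<Sum>c'\<in>C. (a c * b c') *\<^sub>R (c \<odot> (c' \<odot> z)))"
    by (simp add: jprod.sum_left jprod.sum_right jprod.scaleR_left jprod.scaleR_right scaleR_sum_right)
      (subst sum.swap, simp add: mult.commute)
  also have "\<dots> = (\<Sum>c\<in>C. \<Sum>c'\<in>C. (a c * b c') *\<^sub>R (c' \<odot> (c \<odot> z)))"
    by (intro sum.cong refl) (simp add: comm)
  also have "\<dots> = (\<Sum>c'\<in>C. b c' *\<^sub>R c') \<odot> ((\<Sum>c\<in>C. a c *\<^sub>R c) \<odot> z)"
    by (simp add: jprod.sum_left jprod.sum_right jprod.scaleR_left jprod.scaleR_right scaleR_sum_right
        mult.commute)
  finally show ?thesis .
qed

lemma idempotent_system_sum_selfadjoint: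
  fixes C :: "'a::euclidean_jordan_algebra set"
  assumes "idempotent_system C"
  shows "((\<Sum>c\<in>C. a c *\<^sub>R c) \<odot> x) \<bullet> y = x \<bullet> ((\<Sum>c\<in>C. a c *\<^sub>R c) \<odot> y)"
proof -
  have "(c \<odot> x) \<bullet> y = x \<bullet> (c \<odot> y)" if "c \<in> C" for c
    using assms that by (intro idempotent_selfadjoint) (auto simp: idempotent_system_def)
  then show ?thesis
    by (simp add: jprod.sum_left jprod.scaleR_left inner_sum_left inner_sum_right)
qed

text \<open>Reciprocal coefficients on one system give inverse elements with commuting
  multiplications, as \<open>jquad_inverse\<close> demands.\<close>

lemma jquad_idempotent_system_inverse:
  assumes C: "idempotent_system C" and ab: "\<And>c. c \<in> C \<Longrightarrow> a c * b c = 1"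
  shows "jquad (\<Sum>c\<in>C. a c *\<^sub>R c) (jquad (\<Sum>c\<in>C. b c *\<^sub>R c) v) = v"
proof (rule jquad_inverse)
  have *: "a c * (b c * b c) = b c" if "c \<in> C" for c
    using ab[OF that] by (simp flip: mult.assoc)
  show "(\<Sum>c\<in>C. a c *\<^sub>R c) \<odot> ((\<Sum>c\<in>C. b c *\<^sub>R c) \<odot> (\<Sum>c\<in>C. b c *\<^sub>R c)) = (\<Sum>c\<in>C. b c *\<^sub>R c)"
    unfolding idempotent_system_sum_mult[OF C] by (intro sum.cong refl) (simp only: *)
  show "(\<Sum>c\<in>C. a c *\<^sub>R c) \<odot> (\<Sum>c\<in>C. b c *\<^sub>R c) = jone"
    using C ab by (simp add: idempotent_system_sum_mult[OF C]) (simp add: idempotent_system_def)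
  show "(\<Sum>c\<in>C. b c *\<^sub>R c) \<odot> ((\<Sum>c\<in>C. a c *\<^sub>R c) \<odot> z)
      = (\<Sum>c\<in>C. a c *\<^sub>R c) \<odot> ((\<Sum>c\<in>C. b c *\<^sub>R c) \<odot> z)"
    "((\<Sum>c\<in>C. b c *\<^sub>R c) \<odot> (\<Sum>c\<in>C. b c *\<^sub>R c)) \<odot> ((\<Sum>c\<in>C. a c *\<^sub>R c) \<odot> z)
      = (\<Sum>c\<in>C. a c *\<^sub>R c) \<odot> (((\<Sum>c\<in>C. b c *\<^sub>R c) \<odot> (\<Sum>c\<in>C. b c *\<^sub>R c)) \<odot> z)" for z
    unfolding idempotent_system_sum_mult[OF C] by (rule idempotent_system_sum_commute[OF C])+
qed

lemma jquad_idempotent_system_selfadjoint: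
  fixes C :: "'a::euclidean_jordan_algebra set"
  assumes C: "idempotent_system C"
  shows "jquad (\<Sum>c\<in>C. a c *\<^sub>R c) x \<bullet> y = x \<bullet> jquad (\<Sum>c\<in>C. a c *\<^sub>R c) y"
  by (simp add: jquad_def inner_diff_left inner_diff_right idempotent_system_sum_mult[OF C]
      idempotent_system_sum_selfadjoint[OF C])

lemma jquad_idempotent_system_sum:
  assumes C: "idempotent_system C"
  shows "jquad (\<Sum>c\<in>C. a c *\<^sub>R c) (\<Sum>c\<in>C. b c *\<^sub>R c) = (\<Sum>c\<in>C. ((a c)\<^sup>2 * b c) *\<^sub>R c)"
  by (simp add: jquad_def idempotent_system_sum_mult[OF C] scaleR_sum_right
      algebra_simps power2_eq_square flip: sum_subtractf scaleR_diff_left)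

lemma linear_jquad: "linear (jquad u)"
  by (rule linearI) (simp_all add: jquad_def jprod.add_right jprod.scaleR_right algebra_simps)

text \<open>Subtracting a small multiple of \<open>jone\<close> leaves \<open>s\<close> in the cone,
  hence a square \<open>u \<odot> u\<close>. A frame for \<open>u\<close> then diagonalizes
  \<open>s\<close> with eigenvalues \<open>\<delta> + m c * m c\<close>.\<close>

lemma interior_square_cone_spectral:
  fixes s :: "'a::euclidean_jordan_algebra"
  assumes "s \<in> interior square_cone"
  obtains C l where "spectral_decomposition s C l" "\<And>c. c \<in> C \<Longrightarrow> l c > 0"
proof -
  obtain r where r: "r > 0" "ball s r \<subseteq> square_cone"
    using assms by (auto simp: mem_interior)
  define \<delta> where "\<delta> = r / (norm (jone :: 'a) + 1)"
  have \<delta>: "\<delta> > 0"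
    using r by (simp add: \<delta>_def add_nonneg_pos)
  have "\<delta> * norm (jone :: 'a) < r"
    using r by (simp add: \<delta>_def pos_divide_less_eq add_nonneg_pos)
  then have "s - \<delta> *\<^sub>R jone \<in> square_cone"
    using r \<delta> by (intro subsetD[OF r(2)]) (simp add: dist_norm)
  then obtain u where u: "s - \<delta> *\<^sub>R jone = u \<odot> u"
    by (auto simp: square_cone_def)
  obtain C m where dec: "spectral_decomposition u C m"
    using spectral_decomposition_exists by blast
  note C = spectral_decomposition_idempotent_system[OF dec]
  have one: "jone = \<Sum>C"
    using C by (simp add: idempotent_system_def)
  have "s = \<delta> *\<^sub>R jone + u \<odot> u"
    by (simp flip: u)
  also have "u = (\<Sum>c\<in>C. m c *\<^sub>R c)"
    using dec by (simp add: spectral_decomposition_def)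
  finally have "s = (\<Sum>c\<in>C. (\<delta> + m c * m c) *\<^sub>R c)"
    by (simp add: idempotent_system_sum_mult[OF C] one scaleR_sum_right scaleR_add_left sum.distrib)
  then have "spectral_decomposition s C (\<lambda>c. \<delta> + m c * m c)"
    using dec by (simp add: spectral_decomposition_def)
  then show thesis
    using \<delta> by (elim that) (auto simp: add_pos_nonneg)
qed

section \<open>Newton and Nesterov--Todd directions\<close>

lemma affine_translate_iff: "z \<in> affine_translate a L \<longleftrightarrow> z - a \<in> L"
  by (force simp: affine_translate_def)

text \<open>Relates the affine conditions of the NT system to those of the Newton system, where the
  base points carry the factor \<open>1 / sqrt \<mu>\<close>.\<close>

lemma scaleR_mem_affine_translate:
  assumes "subspace L" "m \<noteq> 0"
  shows "m *\<^sub>R z \<in> affine_translate a L \<longleftrightarrow> z \<in> affine_translate ((1 / m) *\<^sub>R a) L"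
proof -
  have "m *\<^sub>R z - a = m *\<^sub>R (z - (1 / m) *\<^sub>R a)" "z - (1 / m) *\<^sub>R a = (1 / m) *\<^sub>R (m *\<^sub>R z - a)"
    using assms(2) by (simp_all add: scaleR_diff_right)
  then show ?thesis
    unfolding affine_translate_iff using subspace_scale[OF assms(1)] by metis
qed

text \<open>With \<open>M = S ` L\<close>, the two conditions put \<open>d\<close> into a translate of \<open>M\<close> and into a translate of
  its orthogonal complement.\<close>

lemma scaled_system_unique:
  fixes S T :: "'a::euclidean_jordan_algebra \<Rightarrow> 'a"
  assumes L: "subspace L" and lin: "linear S" "linear T"
    and inv: "\<And>z. S (T z) = z" "\<And>z. T (S z) = z"
    and adj: "\<And>x y. S x \<bullet> y = x \<bullet> S y"
  shows "\<exists>!d. T (e + d) \<in> affine_translate a L \<and> S (e - d) \<in> affine_translate b (orthogonal_comp L)"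
proof (rule ex_ex1I)
  have span: "span (S ` L) = S ` L"
    using L by (metis linear_span_image[OF lin(1)] span_eq_iff)
  \<comment> \<open>A solution differs from \<open>S a - e\<close> by an element of the image of
    \<open>L\<close> under \<open>S\<close>, and from \<open>e - T b\<close> by a vector orthogonal
    to it. Decomposing the difference of these two points yields both corrections.\<close>
  obtain m n where m: "m \<in> S ` L" and n: "\<And>w. w \<in> S ` L \<Longrightarrow> n \<bullet> w = 0"
    and mn: "(e - T b) - (S a - e) = m + n"
    using orthogonal_subspace_decomp_exists[of "S ` L" "(e - T b) - (S a - e)"]
    unfolding span orthogonal_def by blast
  define d where "d = S a - e + m"
  have "T (e + d) - a = T m"
    by (simp add: d_def linear_add[OF lin(2)] inv)
  moreover have "T m \<in> L"
    using m inv by auto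
  moreover have "e - d = T b + n"
    using mn by (simp add: d_def algebra_simps)
  then have "S (e - d) - b = S n"
    by (simp add: linear_add[OF lin(1)] inv)
  moreover have "S n \<in> orthogonal_comp L"
    using n by (auto simp: orthogonal_comp_def orthogonal_def inner_commute[of _ "S n"] adj)
  ultimately show "\<exists>d. T (e + d) \<in> affine_translate a L \<and> S (e - d) \<in> affine_translate b (orthogonal_comp L)"
    unfolding affine_translate_iff by metis
next
  fix d d'
  assume d: "T (e + d) \<in> affine_translate a L \<and> S (e - d) \<in> affine_translate b (orthogonal_comp L)"
    and d': "T (e + d') \<in> affine_translate a L \<and> S (e - d') \<in> affine_translate b (orthogonal_comp L)"
  have "T (d - d') = T (e + d) - T (e + d')" "S (d - d') = S (e - d') - S (e - d)"
    by (simp_all add: linear_add[OF lin(2)] linear_diff[OF lin(2)] linear_diff[OF lin(1)])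
  then have "T (d - d') \<in> L" and "S (d - d') \<in> orthogonal_comp L"
    using subspace_diff[OF L, of "T (e + d) - a" "T (e + d') - a"]
      subspace_diff[OF subspace_orthogonal_comp, of "S (e - d') - b" L "S (e - d) - b"] d d'
    by (simp_all add: affine_translate_iff)
  then have "T (d - d') \<bullet> S (d - d') = 0"
    by (auto simp: orthogonal_comp_def orthogonal_def)
  \<comment> \<open>Moving \<open>S\<close> across the inner product cancels \<open>T\<close> and
    leaves the squared norm of \<open>d - d'\<close>.\<close>
  then show "d = d'"
    by (simp add: inv flip: adj)
qed

lemma jpowr_half_eq:
  assumes "spectral_decomposition u C l" "\<And>c. c \<in> C \<Longrightarrow> l c > 0"
  shows "jpowr u (1/2) = (\<Sum>c\<in>C. sqrt (l c) *\<^sub>R c)"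
    and "jpowr u (-1/2) = (\<Sum>c\<in>C. (1 / sqrt (l c)) *\<^sub>R c)"
proof -
  have "l c powr (-1/2) = 1 / sqrt (l c)" if "c \<in> C" for c
    using assms(2)[OF that] powr_minus_divide[of "l c" "1/2"] by (simp add: powr_half_sqrt)
  moreover have "l c powr (1/2) = sqrt (l c)" if "c \<in> C" for c
    using assms(2)[OF that] by (simp add: powr_half_sqrt)
  ultimately show "jpowr u (1/2) = (\<Sum>c\<in>C. sqrt (l c) *\<^sub>R c)"
    and "jpowr u (-1/2) = (\<Sum>c\<in>C. (1 / sqrt (l c)) *\<^sub>R c)"
    by (simp_all add: jpowr_def jspectral_eq[OF assms(1)])
qed

section \<open>The first-order expansion of the exponential\<close>

text \<open>The lower bound is \<open>1 + t \<le> exp t\<close>. For negative \<open>t\<close> the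
  upper bound follows from \<open>exp t * (1 - t) \<le> 1 \<le> 1 - t ^ 3\<close> on dividing by
  \<open>1 - t\<close>.\<close>

lemma exp_remainder_bound:
  fixes t :: real
  assumes "\<bar>t\<bar> \<le> 1"
  shows "\<bar>exp t - 1 - t\<bar> \<le> t\<^sup>2"
proof -
  have "exp t \<le> 1 + t + t\<^sup>2"
  proof (cases "t \<ge> 0")
    case False
    have "exp t * (1 - t) \<le> exp t * exp (- t)"
      using exp_ge_add_one_self[of "- t"] by (intro mult_left_mono) auto
    also have "\<dots> \<le> 1 - t ^ 3"
      using False by (simp flip: exp_add)
    also have "\<dots> = (1 + t + t\<^sup>2) * (1 - t)"
      by (simp add: algebra_simps power2_eq_square power3_eq_cube)
    finally show ?thesis
      using False by simp
  qed (use assms exp_bound in auto)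
  then show ?thesis
    using exp_ge_add_one_self[of t] zero_le_power2[of t] by linarith
qed

lemma norm_idempotent_system_sum:
  fixes C :: "'a::euclidean_jordan_algebra set"
  assumes "idempotent_system C"
  shows "(norm (\<Sum>c\<in>C. a c *\<^sub>R c))\<^sup>2 = (\<Sum>c\<in>C. (a c)\<^sup>2 * (norm c)\<^sup>2)"
proof -
  have "pairwise (\<lambda>c c'. orthogonal (a c *\<^sub>R c) (a c' *\<^sub>R c')) C"
    using assms by (auto simp: pairwise_def orthogonal_def idempotent_system_def
        intro!: inner_eq_zero_if_jprod_eq_zero)
  then show ?thesis
    using assms by (subst norm_sum_Pythagorean) (auto simp: idempotent_system_def power_mult_distrib)
qed

text \<open>A nonzero idempotent \<open>c\<close> has norm at least \<open>1 / K\<close>, because \<open>norm c \<le> K * (norm c)\<^sup>2\<close>. This bounds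
  the eigenvalues of \<open>h\<close> by \<open>K * norm h\<close>.\<close>

lemma jexp_remainder_bound:
  obtains K where "K > 0"
    "\<And>h :: 'a::euclidean_jordan_algebra. norm h \<le> 1 / K \<Longrightarrow> norm (jexp h - jone - h) \<le> K * (norm h)\<^sup>2"
proof -
  obtain K where K: "K > 0" "\<And>a b :: 'a. norm (a \<odot> b) \<le> norm a * norm b * K"
    using jprod.pos_bounded by blast
  have "norm (jexp h - jone - h) \<le> K * (norm h)\<^sup>2" if h: "norm h \<le> 1 / K" for h :: 'a
  proof -
    obtain C l where dec: "spectral_decomposition h C l"
      using spectral_decomposition_exists by blast
    note C = spectral_decomposition_idempotent_system[OF dec]
    have hl: "h = (\<Sum>c\<in>C. l c *\<^sub>R c)" and one: "jone = \<Sum>C" and fin: "finite C"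
      using dec C by (auto simp: spectral_decomposition_def idempotent_system_def)
    have l: "\<bar>l c\<bar> \<le> K * norm h" if c: "c \<in> C" for c
    proof -
      have "norm c \<le> norm c * norm c * K"
        using K(2)[of c c] C c by (simp add: idempotent_system_def)
      moreover have "norm c > 0"
        using C c by (simp add: idempotent_system_def)
      ultimately have nc: "1 \<le> norm c * K"
        by (simp add: mult.assoc)
      have "(l c)\<^sup>2 * (norm c)\<^sup>2 \<le> (norm h)\<^sup>2"
        using norm_idempotent_system_sum[OF C, of l] fin c
        by (simp flip: hl) (rule member_le_sum, auto)
      then have "(\<bar>l c\<bar> * norm c)\<^sup>2 \<le> (norm h)\<^sup>2"
        by (simp add: power_mult_distrib)
      then have "\<bar>l c\<bar> * norm c \<le> norm h"
        by (rule power2_le_imp_le) simp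
      then have "\<bar>l c\<bar> * norm c * K \<le> norm h * K"
        using K(1) by simp
      moreover have "\<bar>l c\<bar> * 1 \<le> \<bar>l c\<bar> * (norm c * K)"
        using nc by (intro mult_left_mono) auto
      ultimately show ?thesis
        by (simp add: mult_ac)
    qed
    have "jexp h - jone - h = (\<Sum>c\<in>C. (exp (l c) - 1 - l c) *\<^sub>R c)"
      by (simp add: jexp_def jspectral_eq[OF dec] one scaleR_diff_left sum_subtractf flip: hl)
    then have "(norm (jexp h - jone - h))\<^sup>2 = (\<Sum>c\<in>C. (exp (l c) - 1 - l c)\<^sup>2 * (norm c)\<^sup>2)"
      by (simp add: norm_idempotent_system_sum[OF C])
    \<comment> \<open>Only one factor of \<open>(l c)\<^sup>2\<close> is bounded by
      \<open>K * norm h\<close>; the other is kept, so that the sum recombines to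
      \<open>(norm h)\<^sup>2\<close>.\<close>
    also have "\<dots> \<le> (\<Sum>c\<in>C. (K * norm h)\<^sup>2 * ((l c)\<^sup>2 * (norm c)\<^sup>2))"
    proof (rule sum_mono)
      fix c assume c: "c \<in> C"
      have "K * norm h \<le> 1"
        using h K(1) by (simp add: field_simps)
      then have "\<bar>exp (l c) - 1 - l c\<bar> \<le> (l c)\<^sup>2"
        using l[OF c] by (intro exp_remainder_bound) auto
      also have "\<dots> \<le> (K * norm h) * \<bar>l c\<bar>"
        using mult_right_mono[OF l[OF c], of "\<bar>l c\<bar>"] by (simp add: power2_eq_square flip: abs_mult)
      finally have "(exp (l c) - 1 - l c)\<^sup>2 \<le> ((K * norm h) * \<bar>l c\<bar>)\<^sup>2"
        using abs_le_square_iff[of "exp (l c) - 1 - l c" "(K * norm h) * \<bar>l c\<bar>"] K(1) by (simp add: abs_mult)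
      then show "(exp (l c) - 1 - l c)\<^sup>2 * (norm c)\<^sup>2 \<le> (K * norm h)\<^sup>2 * ((l c)\<^sup>2 * (norm c)\<^sup>2)"
        by (simp add: power_mult_distrib mult_right_mono flip: mult.assoc)
    qed
    also have "\<dots> = (K * norm h * norm h)\<^sup>2"
      using norm_idempotent_system_sum[OF C, of l] by (simp add: power_mult_distrib flip: sum_distrib_left hl)
    finally have "norm (jexp h - jone - h) \<le> K * norm h * norm h"
      by (rule power2_le_imp_le) (use K(1) in simp)
    then show ?thesis
      by (simp add: power2_eq_square mult.assoc)
  qed
  with K(1) show thesis
    by (rule that)
qed

lemma jexp_zero: "jexp 0 = jone"
proof -
  obtain C :: "'a set" and l where "spectral_decomposition (0 :: 'a) C l"
    using spectral_decomposition_exists by blast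
  then have dec: "spectral_decomposition 0 C (\<lambda>_. 0)" and "\<Sum>C = jone"
    by (auto simp: spectral_decomposition_def jordan_frame_def)
  then show ?thesis
    by (simp add: jexp_def jspectral_eq[OF dec])
qed

lemma jexp_has_derivative_zero:
  "((jexp :: 'a::euclidean_jordan_algebra \<Rightarrow> 'a) has_derivative (\<lambda>h. h)) (at 0)"
proof -
  obtain K where K: "K > 0"
    "\<And>h :: 'a. norm h \<le> 1 / K \<Longrightarrow> norm (jexp h - jone - h) \<le> K * (norm h)\<^sup>2"
    using jexp_remainder_bound by blast
  have lim: "((\<lambda>h :: 'a. K * norm h) \<longlongrightarrow> 0) (at 0)"
    by (rule tendsto_eq_intros refl | simp)+
  show ?thesis
  proof (rule has_derivativeI_sandwich[OF _ bounded_linear_ident _ lim])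
    show "1 / K > 0" using K by simp
    fix h :: 'a assume "h \<noteq> 0" "dist h 0 < 1 / K"
    then show "norm (jexp h - jexp 0 - (h - 0)) / norm (h - 0) \<le> K * norm h"
      using K(2)[of h] by (simp add: jexp_zero pos_divide_le_eq power2_eq_square mult.assoc)
  qed
qed

section \<open>The directions on the central path\<close>

theorem proposition2p6:
  fixes L :: "'a::euclidean_jordan_algebra set"
    and x0 s0 x s w d p dx ds x' s' :: 'a
    and \<mu> :: real and n :: nat
  assumes "jordan_rank TYPE('a) = n"
    and "subspace L"
    and "slater L x0 s0"
    and "x \<in> interior square_cone" and "s \<in> interior square_cone"
    and "\<mu> > 0" and "x = \<mu> *\<^sub>R jinv s"
    and "w = (1 / sqrt \<mu>) *\<^sub>R x"
    and "d = newton_direction L x0 s0 w \<mu>"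
    and "p = scaling_point x s"
    and "(dx, ds) = nt_direction L x0 s0 x s \<mu>"
    and "(x', s') = nt_update L x0 s0 x s \<mu>"
  shows "p = w \<and>
         (dx = d \<and> ds = - d) \<and>
         (x' = sqrt \<mu> *\<^sub>R jquad (jpowr w (1/2)) (jone + d) \<and>
          s' = sqrt \<mu> *\<^sub>R jquad (jpowr w (-1/2)) (jone - d) \<and>
          first_order_taylor (jexp :: 'a \<Rightarrow> 'a) 0 (\<lambda>h. jone + h) \<and>
          first_order_taylor (\<lambda>h :: 'a. jexp (- h)) 0 (\<lambda>h. jone - h))"
proof -
  define m where "m = sqrt \<mu>"
  have m: "m > 0" "\<mu> = m\<^sup>2"
    using \<open>\<mu> > 0\<close> by (auto simp: m_def)
  obtain C l where dec: "spectral_decomposition s C l" and pos: "\<And>c. c \<in> C \<Longrightarrow> l c > 0"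
    using interior_square_cone_spectral[OF \<open>s \<in> interior square_cone\<close>] by blast
  \<comment> \<open>\<open>F f\<close> has the eigenvalues \<open>f\<close> on the frame of
    \<open>s\<close>. Since \<open>x\<close>, \<open>w\<close> and \<open>jone\<close> are of this
    form, the maps act on coefficient functions.\<close>
  define F where "F f = (\<Sum>c\<in>C. f c *\<^sub>R c)" for f :: "'a \<Rightarrow> real"
  note C = spectral_decomposition_idempotent_system[OF dec]
  have F_dec: "spectral_decomposition (F f) C f" for f
    using dec by (simp add: spectral_decomposition_def F_def)
  have F_scale: "r *\<^sub>R F f = F (\<lambda>c. r * f c)" for r f
    by (simp add: F_def scaleR_sum_right)
  have F_cong: "F f = F g" if "\<And>c. c \<in> C \<Longrightarrow> f c = g c" for f g
    using that by (simp add: F_def)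
  have F_quad: "jquad (F f) (F g) = F (\<lambda>c. (f c)\<^sup>2 * g c)" for f g
    unfolding F_def by (rule jquad_idempotent_system_sum[OF C])
  have F_half: "jpowr (F f) (1/2) = F (\<lambda>c. sqrt (f c))" "jpowr (F f) (-1/2) = F (\<lambda>c. 1 / sqrt (f c))"
    if "\<And>c. c \<in> C \<Longrightarrow> f c > 0" for f
    using jpowr_half_eq[OF F_dec that] by (simp_all add: F_def)
  have F_inv: "jinv (F f) = F (\<lambda>c. inverse (f c))" for f
    unfolding jinv_def jspectral_eq[OF F_dec] by (simp add: F_def)
  have one: "jone = F (\<lambda>_. 1)"
    using C by (simp add: F_def idempotent_system_def)
  have s: "s = F l"
    using dec by (simp add: spectral_decomposition_def F_def)
  have x: "x = F (\<lambda>c. m\<^sup>2 / l c)"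
    unfolding \<open>x = \<mu> *\<^sub>R jinv s\<close> s F_inv F_scale m(2) by (simp add: divide_inverse)
  have w: "w = F (\<lambda>c. m / l c)"
    unfolding \<open>w = _\<close> x F_scale m_def[symmetric] using m by (intro F_cong) (simp add: power2_eq_square)

  have x_half: "jpowr x (1/2) = F (\<lambda>c. sqrt (m\<^sup>2 / l c))"
    unfolding x by (rule F_half) (use pos m in auto)
  have w_half: "jpowr w (1/2) = F (\<lambda>c. sqrt (m / l c))" "jpowr w (-1/2) = F (\<lambda>c. 1 / sqrt (m / l c))"
    unfolding w by (rule F_half; use pos m in auto)+

  have "jquad (jpowr x (1/2)) s = F (\<lambda>c. m\<^sup>2)"
    unfolding x_half s F_quad
    by (rule F_cong) (use pos in \<open>auto simp: less_imp_le less_imp_neq[symmetric]\<close>)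
  then have "jpowr (jquad (jpowr x (1/2)) s) (-1/2) = F (\<lambda>c. 1 / m)"
    using m F_half(2)[of "\<lambda>_. m\<^sup>2"] by simp
  then have "scaling_point x s = jquad (jpowr x (1/2)) (F (\<lambda>c. 1 / m))"
    by (simp add: scaling_point_def)
  also have "\<dots> = w"
    unfolding x_half w F_quad
    by (rule F_cong) (use pos m in \<open>auto simp: less_imp_le power2_eq_square\<close>)
  finally have p: "scaling_point x s = w" .

  define T where "T = jquad (jpowr w (1/2))"
  define S where "S = jquad (jpowr w (-1/2))"
  have T_F: "T (F f) = F (\<lambda>c. m / l c * f c)" and S_F: "S (F f) = F (\<lambda>c. l c / m * f c)" for f
    unfolding T_def S_def w_half F_quad
    by (rule F_cong; use pos m in \<open>auto simp: power_divide less_imp_le\<close>)+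
  have "nt_scaled x s \<mu> = (1 / m) *\<^sub>R S x"
    by (simp add: nt_scaled_def p S_def m_def)
  also have "\<dots> = jone"
    unfolding x S_F F_scale one using pos m by (intro F_cong) (auto simp: power2_eq_square less_imp_neq[symmetric])
  finally have v: "nt_scaled x s \<mu> = jone" .
  have v_inv: "jinv jone = (jone :: 'a)"
    by (simp add: one F_inv)
  \<comment> \<open>The current pair comes from \<open>jone\<close> itself, so a step from it has
    the form \<open>T (jone + a)\<close>, \<open>S (jone + b)\<close> up to the factor
    \<open>m\<close>.\<close>
  have xT: "x = m *\<^sub>R T jone" and sS: "s = m *\<^sub>R S jone"
    unfolding x s one T_F S_F F_scale using m by (auto intro!: F_cong simp: power2_eq_square)
  have linT: "linear T" and linS: "linear S"
    by (simp_all add: T_def S_def linear_jquad)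
  have step: "nt_step x s \<mu> (a, b) = (m *\<^sub>R T (jone + a), m *\<^sub>R S (jone + b))" for a b
    unfolding nt_step_def p m_def[symmetric] T_def[symmetric] S_def[symmetric]
    by (simp add: linear_add[OF linT] linear_add[OF linS] scaleR_add_right flip: xT sS)

  define N where "N d \<longleftrightarrow> T (jone + d) \<in> affine_translate ((1 / m) *\<^sub>R x0) L \<and>
    S (jone - d) \<in> affine_translate ((1 / m) *\<^sub>R s0) (orthogonal_comp L)" for d
  have unique: "\<exists>!d. N d"
    unfolding N_def
  proof (rule scaled_system_unique[OF \<open>subspace L\<close> linS linT])
    show "S x \<bullet> y = x \<bullet> S y" for x y
      unfolding S_def w_half F_def by (rule jquad_idempotent_system_selfadjoint[OF C])
    have "sqrt (m / l c) * (1 / sqrt (m / l c)) = 1" if "c \<in> C" for c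
      using pos[OF that] m by simp
    then show "S (T z) = z" "T (S z) = z" for z
      unfolding S_def T_def w_half F_def
      by (auto intro!: jquad_idempotent_system_inverse[OF C] simp: mult.commute
          simp del: times_divide_eq_left times_divide_eq_right)
  qed
  have "d = (THE d. N d)"
    by (simp add: \<open>d = newton_direction L x0 s0 w \<mu>\<close> newton_direction_def N_def T_def S_def m_def)
  then have d: "N d"
    using theI'[OF unique] by simp
  \<comment> \<open>As \<open>nt_scaled x s \<mu>\<close> is \<open>jone\<close>, the third NT
    equation has right-hand side zero and forces \<open>snd e = - fst e\<close>. The other two
    become the Newton system for \<open>fst e\<close>.\<close>
  have "nt_direction L x0 s0 x s \<mu> = (THE e. N (fst e) \<and> snd e = - fst e)"
  proof -
    have "fst (nt_step x s \<mu> e) \<in> affine_translate x0 L \<and>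
        snd (nt_step x s \<mu> e) \<in> affine_translate s0 (orthogonal_comp L) \<and>
        fst e + snd e = jinv (nt_scaled x s \<mu>) - nt_scaled x s \<mu> \<longleftrightarrow> N (fst e) \<and> snd e = - fst e" for e
    proof (cases e)
      case (Pair a b)
      have "a + b = 0 \<longleftrightarrow> b = - a"
        by (rule add_eq_0_iff)
      then show ?thesis
        using m(1) by (auto simp: Pair step v v_inv N_def
            scaleR_mem_affine_translate[OF \<open>subspace L\<close>]
            scaleR_mem_affine_translate[OF subspace_orthogonal_comp])
    qed
    then show ?thesis
      by (simp add: nt_direction_def)
  qed
  also have "\<dots> = (d, - d)"
    using d unique by (intro the_equality) (auto simp: prod_eq_iff)
  finally have dir: "nt_direction L x0 s0 x s \<mu> = (d, - d)" .
  have upd: "nt_update L x0 s0 x s \<mu> = (m *\<^sub>R T (jone + d), m *\<^sub>R S (jone - d))"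
    by (simp add: nt_update_def dir step)
  have "first_order_taylor (jexp :: 'a \<Rightarrow> 'a) 0 (\<lambda>h. jone + h)"
    unfolding first_order_taylor_def
    by (intro exI[of _ "\<lambda>h. h"]) (simp add: jexp_zero jexp_has_derivative_zero)
  moreover have "((\<lambda>h :: 'a. jexp (- h)) has_derivative (\<lambda>h. - h)) (at 0)"
    by (rule has_derivative_compose[where g = jexp and g' = "\<lambda>h. h"])
      (simp_all add: jexp_has_derivative_zero has_derivative_minus)
  then have "first_order_taylor (\<lambda>h :: 'a. jexp (- h)) 0 (\<lambda>h. jone - h)"
    unfolding first_order_taylor_def
    by (intro exI[of _ "\<lambda>h. - h"]) (simp add: jexp_zero)
  ultimately show ?thesis
    using p upd assms(10-12) unfolding dir T_def S_def m_def by (intro conjI) simp_all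
qed

end
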